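(* Let $\Phi$ be a finite crystallographic root system in a real vector space $V$ of dimension $n$ with simple roots $\alpha_1,\dots,\alpha_n$, Weyl group $W$, and a bipartition $I=I_+\sqcup I_-$ of its Dynkin diagram, with signs $\varepsilon(i)$. Let $L:V\to V$ be the linear map with $L(\alpha_i)=\varepsilon(i)\omega_i$ for all $i$. Then the image under $L$ of the cluster fan of $\Phi$ is a fan that is refined by the normal fan of the $W$-permutohedron; that is, every cone of the image fan is a union of cones of the Coxeter fan of $W$ in $V$.
   Context: Fix a $W$-invariant inner product $\langle\cdot,\cdot\rangle$ on $V$. Coroots are $\alpha^\vee=2\alpha/\langle\alpha,\alpha\rangle$; the fundamental weights $\omega_j$ are defined by $\langle\alpha_i^\vee,\omega_j\rangle=\delta_{ij}$. A bipartition $I_+\sqcup I_-$ of the index set $I=\{1,\dots,n\}$ means each $I_\pm$ contains no two adjacent vertices of the Dynkin diagram; $\varepsilon(i)=+1$ if $i\in I_+$ and $-1$ if $i\in I_-$. Let $\Phi_{\ge-1}$ be the set of positive roots together with the negative simple roots $-\alpha_i$. For $\varepsilon\in\{+,-\}$ define $\tau_\varepsilon:\Phi_{\ge-1}\to\Phi_{\ge-1}$ by $\tau_\varepsilon(\alpha)=\alpha$ if $\alpha=-\alpha_i$ with $i\in I_{-\varepsilon}$, and $\tau_\varepsilon(\alpha)=\big(\prod_{i\in I_\varepsilon}s_i\big)(\alpha)$ otherwise, where $s_i$ is the simple reflection for $\alpha_i$. Compatibility is the unique symmetric relation on $\Phi_{\ge-1}$ such that $-\alpha_i$ is compatible with $\beta$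 iff the coefficient of $\alpha_i$ in $\beta$ (in the basis of simple roots) is $0$, and $\beta,\theta$ are compatible iff $\tau_\varepsilon\beta,\tau_\varepsilon\theta$ are compatible for $\varepsilon=\pm$. A cluster is a maximal set of pairwise compatible elements of $\Phi_{\ge-1}$; clusters are bases of $V$, and the cones spanned by subsets of clusters form a complete simplicial fan, the cluster fan. The Coxeter fan of $W$ in $V$ is the fan formed by the closures of the connected components of the complement of the hyperplanes orthogonal to the roots, together with their faces; it is the normal fan of the $W$-permutohedron. *)

theory Defs
  imports "HOL-Analysis.Analysis"
begin

definition coroot :: "'a::euclidean_space \<Rightarrow> 'a" where
  "coroot \<alpha> = (2 / inner \<alpha> \<alpha>) *\<^sub>R \<alpha>"

definition refl :: "'a::euclidean_space \<Rightarrow> 'a \<Rightarrow> 'a" where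
  "refl \<alpha> v = v - inner (coroot \<alpha>) v *\<^sub>R \<alpha>"

definition root_system :: "'a::euclidean_space set \<Rightarrow> bool" where
  "root_system \<Phi> \<longleftrightarrow>
     finite \<Phi> \<and> 0 \<notin> \<Phi> \<and> span \<Phi> = UNIV \<and>
     (\<forall>\<alpha>\<in>\<Phi>. refl \<alpha> ` \<Phi> = \<Phi>) \<and>
     (\<forall>\<alpha>\<in>\<Phi>. \<forall>\<beta>\<in>\<Phi>. inner (coroot \<alpha>) \<beta> \<in> \<int>) \<and>
     (\<forall>\<alpha>\<in>\<Phi>. \<forall>c::real. c *\<^sub>R \<alpha> \<in> \<Phi> \<longrightarrow> c = 1 \<or> c = -1)"

definition simple_system :: "'a::euclidean_space set \<Rightarrow> (nat \<Rightarrow> 'a) \<Rightarrow> bool" where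
  "simple_system \<Phi> a \<longleftrightarrow>
     (\<forall>i\<in>{1..DIM('a)}. a i \<in> \<Phi>) \<and> inj_on a {1..DIM('a)} \<and>
     independent (a ` {1..DIM('a)}) \<and>
     (\<forall>\<beta>\<in>\<Phi>. \<exists>c::nat \<Rightarrow> int.
        \<beta> = (\<Sum>i\<in>{1..DIM('a)}. of_int (c i) *\<^sub>R a i) \<and>
        ((\<forall>i\<in>{1..DIM('a)}. c i \<ge> 0) \<or> (\<forall>i\<in>{1..DIM('a)}. c i \<le> 0)))"

definition scoeff :: "(nat \<Rightarrow> 'a::euclidean_space) \<Rightarrow> 'a \<Rightarrow> nat \<Rightarrow> real" where
  "scoeff a \<beta> i = (THE c::nat \<Rightarrow> real.
      \<beta> = (\<Sum>j\<in>{1..DIM('a)}. c j *\<^sub>R a j) \<and> (\<forall>j. j \<notin> {1..DIM('a)} \<longrightarrow> c j = 0)) i"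

definition fund_weight :: "(nat \<Rightarrow> 'a::euclidean_space) \<Rightarrow> nat \<Rightarrow> 'a" where
  "fund_weight a j = (THE w. \<forall>i\<in>{1..DIM('a)}.
      inner (coroot (a i)) w = (if i = j then 1 else 0))"

definition pos_roots :: "'a::euclidean_space set \<Rightarrow> (nat \<Rightarrow> 'a) \<Rightarrow> 'a set" where
  "pos_roots \<Phi> a = {\<beta>\<in>\<Phi>. \<forall>i\<in>{1..DIM('a)}. scoeff a \<beta> i \<ge> 0}"

definition almost_pos :: "'a::euclidean_space set \<Rightarrow> (nat \<Rightarrow> 'a) \<Rightarrow> 'a set" where
  "almost_pos \<Phi> a = pos_roots \<Phi> a \<union> {- a i | i. i \<in> {1..DIM('a)}}"

text \<open>Vertices i, j of the Dynkin diagram are adjacent iff i \<noteq> j and <alpha_i, alpha_j> \<noteq> 0.\<close>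
definition bipartition :: "(nat \<Rightarrow> 'a::euclidean_space) \<Rightarrow> nat set \<Rightarrow> nat set \<Rightarrow> bool" where
  "bipartition a Iplus Iminus \<longleftrightarrow>
     Iplus \<inter> Iminus = {} \<and> Iplus \<union> Iminus = {1..DIM('a)} \<and>
     (\<forall>i\<in>Iplus. \<forall>j\<in>Iplus. i \<noteq> j \<longrightarrow> inner (a i) (a j) = 0) \<and>
     (\<forall>i\<in>Iminus. \<forall>j\<in>Iminus. i \<noteq> j \<longrightarrow> inner (a i) (a j) = 0)"

definition sgn_bip :: "nat set \<Rightarrow> nat \<Rightarrow> real" where
  "sgn_bip Iplus i = (if i \<in> Iplus then 1 else -1)"

definition prod_refl :: "(nat \<Rightarrow> 'a::euclidean_space) \<Rightarrow> nat set \<Rightarrow> 'a \<Rightarrow> 'a" where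
  "prod_refl a S = foldr (\<lambda>i f. refl (a i) \<circ> f) (sorted_list_of_set S) id"

text \<open>tau_eps with I_eps = S and I_{-eps} = T.\<close>
definition tau :: "(nat \<Rightarrow> 'a::euclidean_space) \<Rightarrow> nat set \<Rightarrow> nat set \<Rightarrow> 'a \<Rightarrow> 'a" where
  "tau a S T \<beta> = (if \<exists>i\<in>T. \<beta> = - a i then \<beta> else prod_refl a S \<beta>)"

definition is_compat ::
  "'a::euclidean_space set \<Rightarrow> (nat \<Rightarrow> 'a) \<Rightarrow> nat set \<Rightarrow> nat set \<Rightarrow> ('a \<Rightarrow> 'a \<Rightarrow> bool) \<Rightarrow> bool" where
  "is_compat \<Phi> a Iplus Iminus R \<longleftrightarrow>
     (\<forall>x y. R x y \<longrightarrow> x \<in> almost_pos \<Phi> a \<and> y \<in> almost_pos \<Phi> a) \<and>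
     (\<forall>x y. R x y \<longrightarrow> R y x) \<and>
     (\<forall>i\<in>{1..DIM('a)}. \<forall>\<beta>\<in>almost_pos \<Phi> a. R (- a i) \<beta> \<longleftrightarrow> scoeff a \<beta> i = 0) \<and>
     (\<forall>\<beta>\<in>almost_pos \<Phi> a. \<forall>\<theta>\<in>almost_pos \<Phi> a.
        (R \<beta> \<theta> \<longleftrightarrow> R (tau a Iplus Iminus \<beta>) (tau a Iplus Iminus \<theta>)) \<and>
        (R \<beta> \<theta> \<longleftrightarrow> R (tau a Iminus Iplus \<beta>) (tau a Iminus Iplus \<theta>)))"

definition compat ::
  "'a::euclidean_space set \<Rightarrow> (nat \<Rightarrow> 'a) \<Rightarrow> nat set \<Rightarrow> nat set \<Rightarrow> 'a \<Rightarrow> 'a \<Rightarrow> bool" where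
  "compat \<Phi> a Iplus Iminus = (THE R. is_compat \<Phi> a Iplus Iminus R)"

definition pairwise_compat ::
  "'a::euclidean_space set \<Rightarrow> (nat \<Rightarrow> 'a) \<Rightarrow> nat set \<Rightarrow> nat set \<Rightarrow> 'a set \<Rightarrow> bool" where
  "pairwise_compat \<Phi> a Iplus Iminus C \<longleftrightarrow>
     C \<subseteq> almost_pos \<Phi> a \<and> (\<forall>x\<in>C. \<forall>y\<in>C. x \<noteq> y \<longrightarrow> compat \<Phi> a Iplus Iminus x y)"

definition cluster ::
  "'a::euclidean_space set \<Rightarrow> (nat \<Rightarrow> 'a) \<Rightarrow> nat set \<Rightarrow> nat set \<Rightarrow> 'a set \<Rightarrow> bool" where
  "cluster \<Phi> a Iplus Iminus C \<longleftrightarrow> pairwise_compat \<Phi> a Iplus Iminus C \<and>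
     (\<forall>D. pairwise_compat \<Phi> a Iplus Iminus D \<and> C \<subseteq> D \<longrightarrow> D = C)"

definition span_cone :: "'a::real_vector set \<Rightarrow> 'a set" where
  "span_cone S = {y. \<exists>c. (\<forall>x\<in>S. c x \<ge> 0) \<and> y = (\<Sum>x\<in>S. c x *\<^sub>R x)}"

definition cluster_fan ::
  "'a::euclidean_space set \<Rightarrow> (nat \<Rightarrow> 'a) \<Rightarrow> nat set \<Rightarrow> nat set \<Rightarrow> 'a set set" where
  "cluster_fan \<Phi> a Iplus Iminus = {span_cone S | S C. cluster \<Phi> a Iplus Iminus C \<and> S \<subseteq> C}"

definition coxeter_fan :: "'a::euclidean_space set \<Rightarrow> 'a set set" where
  "coxeter_fan \<Phi> = {G. \<exists>C \<in> components (UNIV - (\<Union>\<beta>\<in>\<Phi>. {v. inner \<beta> v = 0})).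
       G face_of closure C \<and> G \<noteq> {}}"

definition is_fan :: "'a::euclidean_space set set \<Rightarrow> bool" where
  "is_fan F \<longleftrightarrow>
     (\<forall>K\<in>F. polyhedron K \<and> cone K \<and> K \<noteq> {}) \<and>
     (\<forall>K\<in>F. \<forall>G. G face_of K \<and> G \<noteq> {} \<longrightarrow> G \<in> F) \<and>
     (\<forall>K1\<in>F. \<forall>K2\<in>F. (K1 \<inter> K2) face_of K1 \<and> (K1 \<inter> K2) face_of K2)"

end

theory Submission
  imports Defs
begin

text \<open>
  Pairing with a root turns L into a bilinear form: \<open>\<langle>\<gamma>, L \<beta>\<rangle>\<close> is the diagonal form with entries
  \<open>\<epsilon>(i) \<langle>\<alpha>\<^sub>i, \<alpha>\<^sub>i\<rangle> / 2\<close> in the basis of simple roots. Twisting it by the product of the reflections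
  of one colour gives the Euler form of the bipartite orientation, from which compatibility can be
  read off explicitly, and each product of reflections is, up to sign, adjoint to the other one.

  The product of the two is a Coxeter element. It has finite order and fixes no nonzero vector, so
  alternating the two moves every nonzero vector out of the positive orthant. Once a negative simple
  root occurs in a cluster, the rest of the cluster lives in a proper parabolic subsystem, and
  induction on the rank applies. This yields that expansions of vectors in compatible almost positive
  roots are unique, which is the fan property, and that for each cluster C the basis dual to
  L(C) consists of multiples of roots. Hence the walls of the cones of the image fan are reflecting
  hyperplanes, and these cones are unions of cones of the Coxeter fan.
\<close>

section \<open>Coordinates and products of commuting reflections\<close>

text \<open>The obstacle is that the maps \<open>tau\<close> are only piecewise linear, whereas
  expansions and dual bases are linear data. They differ from a linear map only at negative simple
  roots of the colour not being reflected, and the presence of a negative simple root is exactly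
  what permits a reduction of rank. This dictates a double induction: on the index set
  \<open>J\<close>, and on the number of alternations until a negative coordinate appears.

  Every alternation exchanges the colours, so statements are proved for either colour class. The
  exchange is harmless: it negates \<open>form\<close> and transposes \<open>euler\<close>, and
  compatibility asks for both Euler values.

  A parabolic subsystem is represented by a support condition \<open>J\<close> inside the fixed root
  system, so that inner product, forms and compatibility never change during the induction.

  Compatibility is given by a definite description. The explicit relation provides existence, and
  the same alternation provides uniqueness. That clusters are bases is not assumed either: it comes
  out together with the dual roots.\<close>

lemma inner_coroot: "inner (coroot \<alpha>) v = 2 * inner \<alpha> v / inner \<alpha> \<alpha>"
  by (simp add: coroot_def)

lemma refl_self: "\<alpha> \<noteq> 0 \<Longrightarrow> refl \<alpha> \<alpha> = - \<alpha>"
  by (simp add: refl_def inner_coroot algebra_simps flip: scaleR_2)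

text \<open>Pigeonhole on the restrictions of the powers of \<open>c\<close> to \<open>B\<close>:
  two of them agree, injectivity cancels the smaller power, and an identity on \<open>B\<close>
  extends to its span.\<close>

lemma linear_finite_order:
  fixes c :: "'a::real_vector \<Rightarrow> 'a"
  assumes lin: "linear c" and inj: "inj c" and fin: "finite B" and sp: "span B = UNIV"
    and im: "c ` B \<subseteq> B"
  obtains N where "N > 0" "c ^^ N = id"
proof -
  have im': "(c ^^ k) x \<in> B" if "x \<in> B" for k x
    using that im by (induction k) auto
  have linp: "linear (c ^^ k)" for k
  proof (induction k)
    case 0
    show ?case using linear_id by (simp add: id_def)
  next
    case (Suc k)
    show ?case using linear_compose[OF Suc lin] by (simp add: comp_def)
  qed
  have "(\<lambda>k. restrict (c ^^ k) B) ` UNIV \<subseteq> PiE B (\<lambda>_. B)"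
    using im' by auto
  then have "finite (range (\<lambda>k. restrict (c ^^ k) B))"
    using finite_subset finite_PiE fin by meson
  then have "\<not> inj (\<lambda>k. restrict (c ^^ k) B)"
    using finite_imageD infinite_UNIV_nat by blast
  then obtain i j where "i \<noteq> j" "restrict (c ^^ i) B = restrict (c ^^ j) B"
    by (auto simp: inj_on_def)
  then obtain i j where ij: "i < j" "restrict (c ^^ i) B = restrict (c ^^ j) B"
    by (metis linorder_neq_iff)
  have "(c ^^ (j - i)) x = id x" if x: "x \<in> B" for x
  proof -
    have "(c ^^ i) ((c ^^ (j - i)) x) = (c ^^ (i + (j - i))) x"
      by (simp only: funpow_add comp_apply)
    also have "\<dots> = (c ^^ j) x" using ij(1) by simp
    also have "\<dots> = (c ^^ i) x"
      using fun_cong[OF ij(2), of x] x by simp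
    finally show ?thesis
      using injD[OF inj_fn[OF inj, of i]] by simp
  qed
  then have "c ^^ (j - i) = id"
    using linear_eq_on_span[OF linp linear_id] sp by (metis UNIV_I ext)
  then show thesis using that[of "j - i"] ij by simp
qed

text \<open>The index set is a parameter of the locale because an abbreviation for the interval
  would hide its dependence on the ambient type.\<close>
locale simple_roots =
  fixes \<Phi> :: "'a::euclidean_space set" and a :: "nat \<Rightarrow> 'a" and I :: "nat set"
  assumes root: "root_system \<Phi>" and simple: "simple_system \<Phi> a"
    and I_eq: "I = {1..DIM('a)}"
begin

lemma fin_I [simp]: "finite I"
  by (simp add: I_eq)

abbreviation co :: "'a \<Rightarrow> nat \<Rightarrow> real" where "co \<equiv> scoeff a"

lemma fin_Phi: "finite \<Phi>" and zero_Phi: "0 \<notin> \<Phi>" and span_Phi: "span \<Phi> = UNIV"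
  and refl_Phi: "\<alpha> \<in> \<Phi> \<Longrightarrow> \<beta> \<in> \<Phi> \<Longrightarrow> refl \<alpha> \<beta> \<in> \<Phi>"
  and reduced: "\<alpha> \<in> \<Phi> \<Longrightarrow> c *\<^sub>R \<alpha> \<in> \<Phi> \<Longrightarrow> c = 1 \<or> c = -1"
  using root unfolding root_system_def by blast+

lemma a_Phi: "i \<in> I \<Longrightarrow> a i \<in> \<Phi>" and a_inj: "inj_on a I" and a_indep: "independent (a ` I)"
  using simple unfolding simple_system_def I_eq by blast+

lemma a_nz: "i \<in> I \<Longrightarrow> a i \<noteq> 0"
  using a_Phi zero_Phi by metis

lemma neg_Phi: "\<beta> \<in> \<Phi> \<Longrightarrow> - \<beta> \<in> \<Phi>"
  using refl_Phi[of \<beta> \<beta>] refl_self[of \<beta>] zero_Phi by metis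

lemma a_span: "span (a ` I) = UNIV"
  using a_indep card_image[OF a_inj] card_ge_dim_independent[of "a ` I" UNIV]
  by (auto simp: I_eq)

section \<open>Coordinates in the basis of simple roots\<close>

lemma comb_eq_zero:
  assumes "(\<Sum>i\<in>I. c i *\<^sub>R a i) = 0" "i \<in> I"
  shows "c i = 0"
proof -
  have "(\<Sum>v\<in>a ` I. c (the_inv_into I a v) *\<^sub>R v) = (\<Sum>i\<in>I. c i *\<^sub>R a i)"
    by (subst sum.reindex[OF a_inj]) (auto intro!: sum.cong simp: the_inv_into_f_f[OF a_inj])
  then have z: "(\<Sum>v\<in>a ` I. c (the_inv_into I a v) *\<^sub>R v) = 0" using assms(1) by simp
  have "c (the_inv_into I a (a i)) = 0"
    by (rule independentD[OF a_indep _ _ z]) (use assms(2) in auto)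
  then show ?thesis
    using assms(2) by (simp add: the_inv_into_f_f[OF a_inj])
qed

lemma comb_ex: "\<exists>c. x = (\<Sum>i\<in>I. c i *\<^sub>R a i)"
proof -
  have "x \<in> span (a ` I)" by (simp add: a_span)
  then obtain u where "x = (\<Sum>v\<in>a ` I. u v *\<^sub>R v)"
    unfolding span_finite[OF finite_imageI[OF fin_I]] by auto
  then have "x = (\<Sum>i\<in>I. u (a i) *\<^sub>R a i)"
    by (simp add: sum.reindex[OF a_inj])
  then show ?thesis by (rule exI[of _ "\<lambda>i. u (a i)"])
qed

text \<open>Discharges the definite description in \<open>scoeff\<close>. Vanishing off
  \<open>I\<close> is what makes \<open>c\<close> unique as a function on all of
  \<open>nat\<close>.\<close>

lemma co_unique: "\<exists>!c. x = (\<Sum>j\<in>I. c j *\<^sub>R a j) \<and> (\<forall>j. j \<notin> I \<longrightarrow> c j = 0)"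
proof -
  obtain c where c: "x = (\<Sum>i\<in>I. c i *\<^sub>R a i)" using comb_ex by blast
  show ?thesis
  proof (rule ex1I[of _ "\<lambda>i. if i \<in> I then c i else 0"])
    fix d assume d: "x = (\<Sum>j\<in>I. d j *\<^sub>R a j) \<and> (\<forall>j. j \<notin> I \<longrightarrow> d j = 0)"
    then have "(\<Sum>j\<in>I. (d j - c j) *\<^sub>R a j) = 0"
      using c by (simp add: algebra_simps sum_subtractf)
    then have "d i = c i" if "i \<in> I" for i
      using comb_eq_zero[of "\<lambda>j. d j - c j"] that by fastforce
    then show "d = (\<lambda>i. if i \<in> I then c i else 0)"
      using d by fastforce
  qed (use c in simp)
qed

lemma co_expand: "x = (\<Sum>j\<in>I. co x j *\<^sub>R a j)"
  and co_out: "j \<notin> I \<Longrightarrow> co x j = 0"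
  using theI'[OF co_unique[of x]] unfolding scoeff_def I_eq by auto

lemma co_eqI:
  assumes "x = (\<Sum>j\<in>I. c j *\<^sub>R a j)" "i \<in> I"
  shows "co x i = c i"
proof -
  have "(\<Sum>j\<in>I. (co x j - c j) *\<^sub>R a j) = 0"
    using co_expand[of x] assms by (simp add: algebra_simps sum_subtractf)
  then show ?thesis
    using comb_eq_zero[of "\<lambda>j. co x j - c j"] assms by fastforce
qed

lemma co_add: "co (x + y) i = co x i + co y i"
proof (cases "i \<in> I")
  case True
  have "x + y = (\<Sum>j\<in>I. (co x j + co y j) *\<^sub>R a j)"
    using co_expand[of x] co_expand[of y] by (simp add: algebra_simps sum.distrib)
  from co_eqI[OF this True] show ?thesis .
qed (simp add: co_out)

lemma co_scale: "co (c *\<^sub>R x) i = c * co x i"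
proof (cases "i \<in> I")
  case True
  have "c *\<^sub>R x = (\<Sum>j\<in>I. (c * co x j) *\<^sub>R a j)"
    using arg_cong[OF co_expand[of x], of "(*\<^sub>R) c"] by (simp add: scaleR_sum_right)
  from co_eqI[OF this True] show ?thesis .
qed (simp add: co_out)

lemma linear_co: "linear (\<lambda>x. co x i)"
  by (rule linearI) (simp_all add: co_add co_scale)

lemma co_zero [simp]: "co 0 i = 0"
  and co_minus [simp]: "co (- x) i = - co x i"
  and co_diff: "co (x - y) i = co x i - co y i"
  and co_sum: "co (\<Sum>x\<in>A. f x) i = (\<Sum>x\<in>A. co (f x) i)"
  using linear_0[OF linear_co[of i]] linear_neg[OF linear_co[of i]]
    linear_diff[OF linear_co[of i]] linear_sum[OF linear_co[of i]]
  by simp_all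

lemma co_a: "i \<in> I \<Longrightarrow> co (a i) j = (if i = j then 1 else 0)"
proof (cases "j \<in> I")
  case True
  assume i: "i \<in> I"
  have "a i = (\<Sum>j\<in>I. (if i = j then 1 else 0) *\<^sub>R a j)"
    using i by (simp add: if_distrib[of "\<lambda>r. r *\<^sub>R _"] cong: if_cong)
  from co_eqI[OF this True] show ?thesis .
qed (auto simp: co_out)

lemma co_ext: "(\<And>i. i \<in> I \<Longrightarrow> co x i = co y i) \<Longrightarrow> x = y"
  using co_expand[of x] co_expand[of y] by (metis (no_types, lifting) sum.cong)

lemma inner_expand: "inner x y = (\<Sum>i\<in>I. co x i * inner (a i) y)"
  by (subst co_expand[of x]) (simp add: inner_sum_left)

lemma root_sign: "\<beta> \<in> \<Phi> \<Longrightarrow> (\<forall>i. co \<beta> i \<ge> 0) \<or> (\<forall>i. co \<beta> i \<le> 0)"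
proof -
  assume "\<beta> \<in> \<Phi>"
  then obtain c where c: "\<beta> = (\<Sum>i\<in>I. real_of_int (c i) *\<^sub>R a i)"
    "(\<forall>i\<in>I. c i \<ge> 0) \<or> (\<forall>i\<in>I. c i \<le> 0)"
    using simple unfolding simple_system_def I_eq by blast
  have "\<And>i. i \<in> I \<Longrightarrow> co \<beta> i = real_of_int (c i)"
    using co_eqI[OF c(1)] .
  then have "(\<forall>i\<in>I. co \<beta> i \<ge> 0) \<or> (\<forall>i\<in>I. co \<beta> i \<le> 0)" using c(2) by auto
  then show ?thesis by (metis co_out order.refl)
qed

text \<open>For pairwise orthogonal simple roots the reflections do not disturb each other, so their
  product is a single simultaneous subtraction. This form is free of any ordering and changes only
  the coordinates in \<open>S\<close>.\<close>

definition t :: "nat set \<Rightarrow> 'a \<Rightarrow> 'a" where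
  "t S x = x - (\<Sum>i\<in>S. inner (coroot (a i)) x *\<^sub>R a i)"

definition orth :: "nat set \<Rightarrow> bool" where
  "orth S \<longleftrightarrow> S \<subseteq> I \<and> (\<forall>i\<in>S. \<forall>j\<in>S. i \<noteq> j \<longrightarrow> inner (a i) (a j) = 0)"

lemma orth_subset: "orth S \<Longrightarrow> T \<subseteq> S \<Longrightarrow> orth T"
  unfolding orth_def by (meson subsetD subset_trans)

lemma orth_finite: "orth S \<Longrightarrow> finite S"
  unfolding orth_def using finite_subset fin_I by blast

lemma linear_t: "linear (t S)"
  unfolding t_def by (rule linearI)
    (simp_all add: inner_right_distrib algebra_simps sum.distrib scaleR_sum_right)

lemma co_t: "orth S \<Longrightarrow> co (t S x) i = co x i - (if i \<in> S then inner (coroot (a i)) x else 0)"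
proof -
  assume S: "orth S"
  have "(\<Sum>j\<in>S. inner (coroot (a j)) x * co (a j) i) =
      (\<Sum>j\<in>S. if j = i then inner (coroot (a j)) x else 0)"
    by (rule sum.cong) (use S in \<open>auto simp: orth_def co_a\<close>)
  also have "\<dots> = (if i \<in> S then inner (coroot (a i)) x else 0)"
    using orth_finite[OF S] by simp
  finally show ?thesis
    by (simp add: t_def co_diff co_sum co_scale)
qed

lemma coroot_t:
  assumes S: "orth S" and i: "i \<in> S"
  shows "inner (coroot (a i)) (t S x) = - inner (coroot (a i)) x"
proof -
  have "(\<Sum>j\<in>S. inner (coroot (a j)) x * inner (coroot (a i)) (a j)) =
      (\<Sum>j\<in>S. if j = i then inner (coroot (a i)) x * 2 else 0)"
  proof (rule sum.cong, rule refl)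
    fix j assume j: "j \<in> S"
    have "a i \<noteq> 0" using S i a_nz unfolding orth_def by blast
    then show "inner (coroot (a j)) x * inner (coroot (a i)) (a j) =
       (if j = i then inner (coroot (a i)) x * 2 else 0)"
      using S i j unfolding orth_def by (auto simp: inner_coroot)
  qed
  then show ?thesis
    using orth_finite[OF S] i
    by (simp add: t_def inner_diff_right inner_sum_right)
qed

lemma t_invol: "orth S \<Longrightarrow> t S (t S x) = x"
  by (rule co_ext) (simp add: co_t coroot_t)

lemma t_insert:
  assumes "orth (insert i S)" "i \<notin> S"
  shows "t (insert i S) x = refl (a i) (t S x)"
proof -
  have fS: "finite S" using orth_finite[OF assms(1)] by simp
  have "(\<Sum>j\<in>S. inner (coroot (a j)) x * inner (coroot (a i)) (a j)) = 0"
    by (rule sum.neutral) (use assms in \<open>auto simp: orth_def inner_coroot\<close>)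
  then have "inner (coroot (a i)) (t S x) = inner (coroot (a i)) x"
    by (simp add: t_def inner_diff_right inner_sum_right)
  then show ?thesis
    using fS assms(2) by (simp add: refl_def) (simp add: t_def)
qed

lemma t_Phi: "orth S \<Longrightarrow> \<beta> \<in> \<Phi> \<Longrightarrow> t S \<beta> \<in> \<Phi>"
proof -
  assume S: "orth S" and b: "\<beta> \<in> \<Phi>"
  from orth_finite[OF S] S show "t S \<beta> \<in> \<Phi>"
  proof (induction S)
    case empty
    then show ?case using b by (simp add: t_def)
  next
    case (insert i S)
    have "a i \<in> \<Phi>" using insert.prems a_Phi unfolding orth_def by blast
    then show ?case
      using insert orth_subset[OF insert.prems, of S] by (auto simp: t_insert intro: refl_Phi)
  qed
qed

lemma t_a: 
  assumes S: "orth S" and i: "i \<in> S"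
  shows "t S (a i) = - a i"
proof (rule co_ext)
  fix j
  have iI: "i \<in> I" "S \<subseteq> I" using S i unfolding orth_def by auto
  show "co (t S (a i)) j = co (- a i) j"
  proof (cases "j \<in> S \<and> j \<noteq> i")
    case True
    then have "inner (a j) (a i) = 0" using S i unfolding orth_def by blast
    then show ?thesis using True iI by (simp add: co_t[OF S] co_a inner_coroot)
  next
    case False
    then show ?thesis using i iI a_nz[of i] by (auto simp: co_t[OF S] co_a inner_coroot)
  qed
qed

lemma prod_refl_eq:
  assumes "orth S"
  shows "prod_refl a S = t S"
proof -
  have "set xs \<subseteq> S \<Longrightarrow> distinct xs \<Longrightarrow> foldr (\<lambda>i f. refl (a i) \<circ> f) xs id = t (set xs)" for xs
  proof (induction xs)
    case Nil
    then show ?case by (auto simp: t_def)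
  next
    case (Cons i xs)
    then show ?case
      using t_insert[OF orth_subset[OF assms], of i "set xs"] by (auto simp: fun_eq_iff)
  qed
  from this[of "sorted_list_of_set S"] show ?thesis
    using orth_finite[OF assms] by (simp add: prod_refl_def)
qed

definition pos :: "'a \<Rightarrow> bool" where "pos x \<longleftrightarrow> (\<forall>i. co x i \<ge> 0)"

definition supported :: "nat set \<Rightarrow> 'a \<Rightarrow> bool" where "supported J x \<longleftrightarrow> (\<forall>i. i \<notin> J \<longrightarrow> co x i = 0)"

text \<open>\<open>\<Phi>\<^sub>\<ge>\<^sub>-\<^sub>1\<close> for the parabolic subsystem with simple roots indexed by J.\<close>
definition AP :: "nat set \<Rightarrow> 'a set" where
  "AP J = {\<beta>\<in>\<Phi>. pos \<beta> \<and> supported J \<beta>} \<union> {- a i | i. i \<in> J}"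

text \<open>A positive coefficient outside \<open>S\<close> is left unchanged and fixes the sign of
  the image. Otherwise the root is supported on \<open>S\<close>, and by orthogonality one
  reflection negates a single positive coordinate and keeps the rest. One sign per root then forces
  a multiple of \<open>a i\<close>, and reducedness forces \<open>a i\<close> itself.\<close>

lemma pos_t:
  assumes S: "orth S" and b: "\<beta> \<in> \<Phi>" "pos \<beta>" "\<forall>i\<in>S. \<beta> \<noteq> a i"
  shows "pos (t S \<beta>)"
proof (cases "\<exists>i. i \<notin> S \<and> co \<beta> i \<noteq> 0")
  case True
  then obtain i where i: "i \<notin> S" "co \<beta> i \<noteq> 0" by blast
  then have "co (t S \<beta>) i > 0" using b(2) unfolding pos_def
    by (simp add: co_t[OF S] less_le)
  then have "\<not> (\<forall>j. co (t S \<beta>) j \<le> 0)" by (auto simp: not_le)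
  then show ?thesis
    using root_sign[OF t_Phi[OF S b(1)]] unfolding pos_def by blast
next
  case False
  have SI: "S \<subseteq> I" using S unfolding orth_def by blast
  have "\<beta> \<noteq> 0" using b(1) zero_Phi by blast
  then obtain i where "co \<beta> i \<noteq> 0" using co_ext[of \<beta> 0] by auto
  moreover from this have "i \<in> S" using False by blast
  moreover have "co \<beta> i \<ge> 0" using b(2) unfolding pos_def by blast
  ultimately have i: "i \<in> S" "co \<beta> i > 0" by auto
  have iI: "i \<in> I" using i SI by blast
  have s: "refl (a i) \<beta> = t {i} \<beta>" by (simp add: t_def refl_def)
  have oi: "orth {i}" using iI by (simp add: orth_def)
  have "inner (a i) \<beta> = (\<Sum>j\<in>I. co \<beta> j * inner (a j) (a i))"
    using inner_expand[of \<beta> "a i"] by (simp add: inner_commute)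
  also have "\<dots> = (\<Sum>j\<in>I. if j = i then co \<beta> i * inner (a i) (a i) else 0)"
    by (rule sum.cong) (use S i False in \<open>auto simp: orth_def\<close>)
  finally have "inner (a i) \<beta> = co \<beta> i * inner (a i) (a i)" using iI by simp
  then have "inner (coroot (a i)) \<beta> = 2 * co \<beta> i"
    using a_nz[OF iI] by (simp add: inner_coroot)
  then have c: "co (t {i} \<beta>) j = (if j = i then - co \<beta> i else co \<beta> j)" for j
    using co_t[OF oi] by simp
  then have "co (t {i} \<beta>) i < 0" using i by simp
  then have "\<not> (\<forall>j. co (t {i} \<beta>) j \<ge> 0)" by (auto simp: not_le)
  then have le: "\<forall>j. co (t {i} \<beta>) j \<le> 0"
    using root_sign[OF t_Phi[OF oi b(1)]] by blast
  have z: "co \<beta> j = 0" if "j \<noteq> i" for j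
    using c[of j] that b(2) le[rule_format, of j] unfolding pos_def by (simp add: order.antisym)
  have "\<beta> = co \<beta> i *\<^sub>R a i"
    by (rule co_ext) (use iI z in \<open>auto simp: co_scale co_a\<close>)
  then have "co \<beta> i = 1"
    using reduced[OF a_Phi[OF iI], of "co \<beta> i"] b(1) i(2) by auto
  then show ?thesis using \<open>\<beta> = co \<beta> i *\<^sub>R a i\<close> b(3) i(1) by (metis scaleR_one)
qed

section \<open>The Euler form and compatibility\<close>

lemma t_scale: "t S (c *\<^sub>R x) = c *\<^sub>R t S x"
  and t_minus: "t S (- x) = - t S x"
  and t_sum: "t S (\<Sum>x\<in>A. f x) = (\<Sum>x\<in>A. t S (f x))"
  using linear_scale[OF linear_t[of S]] linear_neg[OF linear_t[of S]] linear_sum[OF linear_t[of S]]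
  by simp_all

section \<open>Almost positive roots of parabolic subsystems\<close>

lemma posD: "pos x \<Longrightarrow> co x i \<ge> 0"
  unfolding pos_def by blast

lemma supportedD: "supported J x \<Longrightarrow> i \<notin> J \<Longrightarrow> co x i = 0"
  unfolding supported_def by blast

lemma supported_t: "orth S \<Longrightarrow> S \<subseteq> J \<Longrightarrow> supported J x \<Longrightarrow> supported J (t S x)"
  unfolding supported_def by (auto simp: co_t)

lemma supported_a: "i \<in> J \<Longrightarrow> i \<in> I \<Longrightarrow> supported J (a i)"
  unfolding supported_def by (auto simp: co_a)

lemma supported_minus [simp]: "supported J (- x) \<longleftrightarrow> supported J x"
  unfolding supported_def by simp

lemma pos_a: "i \<in> I \<Longrightarrow> pos (a i)"
  unfolding pos_def by (simp add: co_a)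

lemma not_pos_neg_a: "i \<in> I \<Longrightarrow> \<not> pos (- a i)"
  unfolding pos_def by (auto simp: co_a not_le intro!: exI[of _ i])

lemma a_inj_iff: "i \<in> I \<Longrightarrow> j \<in> I \<Longrightarrow> a i = a j \<longleftrightarrow> i = j"
  using a_inj by (auto dest: inj_onD)

lemma AP_posI: "\<beta> \<in> \<Phi> \<Longrightarrow> pos \<beta> \<Longrightarrow> supported J \<beta> \<Longrightarrow> \<beta> \<in> AP J"
  unfolding AP_def by blast

lemma AP_negI: "i \<in> J \<Longrightarrow> - a i \<in> AP J"
  unfolding AP_def by blast

lemma AP_aI: "J \<subseteq> I \<Longrightarrow> i \<in> J \<Longrightarrow> a i \<in> AP J"
  by (intro AP_posI) (auto intro: a_Phi pos_a supported_a)

lemma AP_cases: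
  assumes "x \<in> AP J"
  obtains (pos) "x \<in> \<Phi>" "pos x" "supported J x" | (neg) i where "i \<in> J" "x = - a i"
  using assms unfolding AP_def by blast

lemma AP_Phi: "J \<subseteq> I \<Longrightarrow> x \<in> AP J \<Longrightarrow> x \<in> \<Phi>"
  by (erule AP_cases) (auto intro: neg_Phi a_Phi)

lemma AP_supported: "J \<subseteq> I \<Longrightarrow> x \<in> AP J \<Longrightarrow> supported J x"
  by (erule AP_cases) (auto intro: supported_a)

lemma AP_mono: "J \<subseteq> K \<Longrightarrow> AP J \<subseteq> AP K"
  unfolding AP_def supported_def by blast

lemma finite_AP: "J \<subseteq> I \<Longrightarrow> finite (AP J)"
  using finite_subset[OF _ fin_Phi] AP_Phi by (metis subsetI)

text \<open>In terms of the paper, \<^term>\<open>tau_par J S\<close> is the map \<open>\<tau>\<^sub>\<epsilon>\<close> of the parabolic subsystem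
  indexed by J, where S is the set of indices of sign \<open>\<epsilon>\<close>.\<close>
definition tau_par :: "nat set \<Rightarrow> nat set \<Rightarrow> 'a \<Rightarrow> 'a" where
  "tau_par J S x = (if \<exists>i\<in>J - S. x = - a i then x else t (J \<inter> S) x)"

text \<open>The first case records for the image the same facts as for \<open>x\<close>, so that
  later arguments can be run backwards from the image.\<close>

lemma tau_par_cases:
  assumes J: "J \<subseteq> I" and S: "orth S" and x: "x \<in> AP J"
  obtains
    (pos) "x \<in> \<Phi>" "pos x" "supported J x" "\<forall>i\<in>J \<inter> S. x \<noteq> a i" "tau_par J S x = t (J \<inter> S) x"
      "pos (t (J \<inter> S) x)" "t (J \<inter> S) x \<in> \<Phi>" "supported J (t (J \<inter> S) x)"
      "\<forall>i\<in>J \<inter> S. t (J \<inter> S) x \<noteq> a i"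
  | (simple) i where "i \<in> J \<inter> S" "x = a i" "tau_par J S x = - a i"
  | (neg) i where "i \<in> J \<inter> S" "x = - a i" "tau_par J S x = a i"
  | (fixed) i where "i \<in> J - S" "x = - a i" "tau_par J S x = - a i"
proof -
  have o: "orth (J \<inter> S)" using S orth_subset by blast
  from x show thesis
  proof (cases rule: AP_cases)
    case pos
    have nn: "\<not> (\<exists>i\<in>J - S. x = - a i)"
      using pos(2) J not_pos_neg_a by blast
    show thesis
    proof (cases "\<exists>i\<in>J \<inter> S. x = a i")
      case True
      then obtain i where i: "i \<in> J \<inter> S" "x = a i" by blast
      then show thesis using that(2) nn t_a[OF o i(1)] unfolding tau_par_def by auto
    next
      case False
      have p: "pos (t (J \<inter> S) x)" using pos_t[OF o pos(1,2)] False by blast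
      have "t (J \<inter> S) x \<noteq> a i" if i: "i \<in> J \<inter> S" for i
      proof
        assume "t (J \<inter> S) x = a i"
        then have "x = - a i" using t_invol[OF o, of x] t_a[OF o i] by simp
        then show False using pos(2) i J not_pos_neg_a by blast
      qed
      then show thesis
        using that(1) pos False nn p t_Phi[OF o pos(1)] supported_t[OF o _ pos(3)]
        unfolding tau_par_def by auto
    qed
  next
    case (neg i)
    show thesis
    proof (cases "i \<in> S")
      case True
      then have i: "i \<in> J \<inter> S" using neg by blast
      have "\<not> (\<exists>j\<in>J - S. x = - a j)" using neg True J a_inj_iff by auto
      then have "tau_par J S x = a i"
        using t_a[OF o i] neg unfolding tau_par_def by (simp add: t_minus)
      then show thesis by (rule that(3)[OF i neg(2)])
    next
      case False
      then have i: "i \<in> J - S" using neg by blast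
      then have "tau_par J S x = - a i" using neg unfolding tau_par_def by auto
      then show thesis by (rule that(4)[OF i neg(2)])
    qed
  qed
qed

lemma tau_par_AP:
  assumes J: "J \<subseteq> I" and S: "orth S" and x: "x \<in> AP J"
  shows "tau_par J S x \<in> AP J"
  using tau_par_cases[OF assms] J
  by cases (auto intro: AP_posI AP_negI AP_aI)

lemma tau_par_invol:
  assumes J: "J \<subseteq> I" and S: "orth S" and x: "x \<in> AP J"
  shows "tau_par J S (tau_par J S x) = x"
proof -
  have o: "orth (J \<inter> S)" using S orth_subset by blast
  have *: "\<not> (\<exists>i\<in>J - S. y = - a i)" if "pos y" for y
    using that J not_pos_neg_a by blast
  show ?thesis
    using assms
  proof (cases rule: tau_par_cases)
    case pos
    then show ?thesis using * t_invol[OF o] unfolding tau_par_def by simp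
  next
    case (simple i)
    then have "\<not> (\<exists>j\<in>J - S. - a i = - a j)" using J a_inj_iff by auto
    then show ?thesis using simple t_a[OF o simple(1)] unfolding tau_par_def
      by (simp add: t_minus)
  next
    case (neg i)
    then have "pos (a i)" using J pos_a by blast
    then show ?thesis using neg * t_a[OF o neg(1)] unfolding tau_par_def by simp
  qed (auto simp: tau_par_def)
qed

section \<open>Bilinear forms attached to a two-colouring\<close>

definition bip :: "nat set \<Rightarrow> bool" where
  "bip S \<longleftrightarrow> orth S \<and> orth (I - S)"

lemma bip_compl: "bip S \<Longrightarrow> bip (I - S)"
  unfolding bip_def orth_def by (metis Diff_subset double_diff order_refl)

lemma bip_orth: "bip S \<Longrightarrow> orth S"
  unfolding bip_def by blast

text \<open>When S is the set of indices of sign \<open>-\<close>, this is \<open>\<langle>x, L y\<rangle>\<close>.\<close>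
definition form :: "nat set \<Rightarrow> 'a \<Rightarrow> 'a \<Rightarrow> real" where
  "form S x y = (\<Sum>i\<in>I. (if i \<in> S then - 1 else 1) * (inner (a i) (a i) / 2) * co x i * co y i)"

text \<open>The Euler form of the bipartite orientation of the Dynkin diagram in which S consists of
  the sources.\<close>
definition euler :: "nat set \<Rightarrow> 'a \<Rightarrow> 'a \<Rightarrow> real" where
  "euler S x y = form S x (t S y)"

lemma form_sym: "form S x y = form S y x"
  unfolding form_def by (rule sum.cong) auto

lemma form_compl: "form (I - S) x y = - form S x y"
  unfolding form_def sum_negf[symmetric] by (rule sum.cong) auto

lemma form_minus_right: "form S x (- y) = - form S x y"
  and form_minus_left: "form S (- x) y = - form S x y"
  unfolding form_def sum_negf[symmetric] by (auto intro!: sum.cong)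

lemma form_a: "i \<in> I \<Longrightarrow> form S (a i) y = (if i \<in> S then - 1 else 1) * (inner (a i) (a i) / 2) * co y i"
proof -
  assume i: "i \<in> I"
  have "form S (a i) y = (\<Sum>j\<in>I. if j = i then (if i \<in> S then - 1 else 1) * (inner (a i) (a i) / 2) * co y i else 0)"
    unfolding form_def by (rule sum.cong) (auto simp: co_a i)
  then show ?thesis using i by simp
qed

text \<open>The two products agree on the coordinates in \<open>J\<close>, and \<open>x\<close> is
  blind to all others. Hence one Euler form serves every parabolic subsystem.\<close>

lemma form_t_par:
  assumes "orth S" "supported J x"
  shows "form S x (t (J \<inter> S) y) = euler S x y"
  unfolding euler_def form_def
proof (rule sum.cong, rule refl)
  fix i
  have "orth (J \<inter> S)" using assms orth_subset by blast
  then show "(if i \<in> S then - 1 else 1) * (inner (a i) (a i) / 2) * co x i * co (t (J \<inter> S) y) i =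
      (if i \<in> S then - 1 else 1) * (inner (a i) (a i) / 2) * co x i * co (t S y) i"
    using assms supportedD[of J x i] by (cases "i \<in> J") (simp_all add: co_t)
qed

text \<open>Orthogonality inside \<open>S\<close> reduces the block of that colour to its diagonal,
  where the reflection adds the full squared length to minus one half of it. The diagonal thus has
  the same sign for both colours.\<close>

lemma euler_explicit:
  assumes "bip S"
  shows "euler S x y = (\<Sum>i\<in>I. inner (a i) (a i) / 2 * co x i * co y i) +
    (\<Sum>i\<in>S. \<Sum>j\<in>I - S. co x i * co y j * inner (a i) (a j))"
proof -
  have o: "orth S" using assms bip_orth by blast
  have SI: "S \<subseteq> I" using o unfolding orth_def by blast
  have fS: "finite S" using o orth_finite by blast
  have *: "co x i * inner (a i) y = inner (a i) (a i) * co x i * co y i +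
      (\<Sum>j\<in>I - S. co x i * co y j * inner (a i) (a j))" if i: "i \<in> S" for i
  proof -
    have "inner (a i) y = (\<Sum>j\<in>I. co y j * inner (a j) (a i))"
      using inner_expand[of y "a i"] by (simp add: inner_commute)
    also have "\<dots> = (\<Sum>j\<in>S. co y j * inner (a j) (a i)) + (\<Sum>j\<in>I - S. co y j * inner (a j) (a i))"
      using sum.subset_diff[OF SI fin_I] by (simp add: add.commute)
    also have "(\<Sum>j\<in>S. co y j * inner (a j) (a i)) = (\<Sum>j\<in>S. if j = i then co y i * inner (a i) (a i) else 0)"
      by (rule sum.cong) (use o i in \<open>auto simp: orth_def\<close>)
    also have "\<dots> = co y i * inner (a i) (a i)" using i fS by simp
    finally show ?thesis
      by (simp add: distrib_left sum_distrib_left mult.assoc mult.left_commute inner_commute)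
  qed
  have "euler S x y = (\<Sum>i\<in>I. (if i \<in> S then - 1 else 1) * (inner (a i) (a i) / 2) * co x i * co y i +
      (if i \<in> S then co x i * inner (a i) y else 0))"
    unfolding euler_def form_def
  proof (rule sum.cong, rule refl)
    fix i assume "i \<in> I"
    then have "inner (a i) (a i) \<noteq> 0" using a_nz by simp
    then show "(if i \<in> S then - 1 else 1) * (inner (a i) (a i) / 2) * co x i * co (t S y) i =
       (if i \<in> S then - 1 else 1) * (inner (a i) (a i) / 2) * co x i * co y i +
       (if i \<in> S then co x i * inner (a i) y else 0)"
      by (auto simp: co_t[OF o] inner_coroot field_simps)
  qed
  also have "\<dots> = (\<Sum>i\<in>I. inner (a i) (a i) / 2 * co x i * co y i +
      (if i \<in> S then \<Sum>j\<in>I - S. co x i * co y j * inner (a i) (a j) else 0))"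
    by (rule sum.cong) (auto simp: *)
  also have "\<dots> = (\<Sum>i\<in>I. inner (a i) (a i) / 2 * co x i * co y i) +
      (\<Sum>i\<in>S. \<Sum>j\<in>I - S. co x i * co y j * inner (a i) (a j))"
    using SI by (simp add: sum.distrib sum.If_cases Int_absorb1)
  finally show ?thesis .
qed

text \<open>Reversing all arrows of the orientation transposes its Euler form.\<close>

lemma euler_compl:
  assumes "bip S"
  shows "euler (I - S) y x = euler S x y"
proof -
  have "I - (I - S) = S" using assms unfolding bip_def orth_def by blast
  moreover have "(\<Sum>i\<in>I - S. \<Sum>j\<in>S. co y i * co x j * inner (a i) (a j)) =
      (\<Sum>i\<in>S. \<Sum>j\<in>I - S. co x i * co y j * inner (a i) (a j))"
    by (subst sum.swap) (simp add: mult.commute inner_commute)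
  ultimately show ?thesis
    using euler_explicit[OF assms] euler_explicit[OF bip_compl[OF assms]]
    by (simp add: mult.commute mult.left_commute)
qed

text \<open>Both sides are Euler values for opposite orientations. The sign comes from
  \<open>form_compl\<close>.\<close>

lemma form_adjoint:
  assumes "bip S" "supported J x" "supported J y"
  shows "form S (t (J \<inter> (I - S)) x) y = - form S x (t (J \<inter> S) y)"
proof -
  have "form S (t (J \<inter> (I - S)) x) y = - form (I - S) y (t (J \<inter> (I - S)) x)"
    by (simp add: form_compl form_sym)
  also have "\<dots> = - euler (I - S) y x"
    using form_t_par[OF bip_orth[OF bip_compl[OF assms(1)]] assms(3)] by simp
  also have "\<dots> = - form S x (t (J \<inter> S) y)"
    using form_t_par[OF bip_orth[OF assms(1)] assms(2)] euler_compl[OF assms(1)] by simp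
  finally show ?thesis .
qed

text \<open>The compatibility relation, in the form suggested by quiver representations: positive roots
  are compatible iff \<open>Ext\<^sup>1\<close> vanishes in both directions, and \<open>Ext\<^sup>1\<close> is the negative part of
  the Euler form. In this form the relation restricts to parabolic subsystems.\<close>
definition cpt :: "nat set \<Rightarrow> 'a \<Rightarrow> 'a \<Rightarrow> bool" where
  "cpt S x y \<longleftrightarrow> x \<in> AP I \<and> y \<in> AP I \<and> x \<noteq> y \<and>
     (\<forall>i\<in>I. x = - a i \<longrightarrow> co y i = 0) \<and> (\<forall>i\<in>I. y = - a i \<longrightarrow> co x i = 0) \<and>
     (pos x \<longrightarrow> pos y \<longrightarrow> euler S x y \<ge> 0 \<and> euler S y x \<ge> 0)"

lemma cpt_sym: "cpt S x y \<longleftrightarrow> cpt S y x"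
  unfolding cpt_def by blast

lemma cpt_compl: "bip S \<Longrightarrow> cpt (I - S) x y \<longleftrightarrow> cpt S x y"
  unfolding cpt_def by (auto simp: euler_compl)

lemma cpt_neg:
  assumes "i \<in> I" "y \<in> AP I"
  shows "cpt S (- a i) y \<longleftrightarrow> co y i = 0"
proof -
  have "y = - a i \<Longrightarrow> co y i \<noteq> 0" using assms by (simp add: co_a)
  moreover have "co (- a i) j = 0" if "co y i = 0" "j \<in> I" "y = - a j" for j
    using that assms by (auto simp: co_a split: if_splits)
  ultimately show ?thesis
    using assms not_pos_neg_a AP_negI a_inj_iff unfolding cpt_def by (auto simp del: co_minus)
qed

lemma cpt_pos:
  assumes "pos x" "pos y" "x \<in> AP I" "y \<in> AP I" 
  shows "cpt S x y \<longleftrightarrow> x \<noteq> y \<and> euler S x y \<ge> 0 \<and> euler S y x \<ge> 0"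
  using assms not_pos_neg_a unfolding cpt_def by blast

text \<open>The bridge between a simple root and its negative: one Euler value is nonnegative for
  free, the other is a negative multiple of the coefficient of \<open>a i\<close> in the reflected
  root. As that coefficient is nonnegative, compatibility means that it vanishes, which is the
  criterion for \<open>- a i\<close> and the reflected root.\<close>

lemma cpt_simple:
  assumes S: "bip S" and J: "J \<subseteq> I" and i: "i \<in> J \<inter> S"
    and x: "x \<in> \<Phi>" "pos x" "supported J x" "\<forall>i\<in>J \<inter> S. x \<noteq> a i"
  shows "cpt S (a i) x \<longleftrightarrow> co (t (J \<inter> S) x) i = 0"
proof -
  have o: "orth (J \<inter> S)" using S bip_orth orth_subset by blast
  have iI: "i \<in> I" "i \<in> S" using i J by auto
  have d: "inner (a i) (a i) > 0" using a_nz[OF iI(1)] by simp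
  have "euler S x (a i) = form S x (- a i)"
    using form_t_par[OF bip_orth[OF S] x(3), of "a i"] t_a[OF o i] by simp
  also have "\<dots> = inner (a i) (a i) / 2 * co x i"
    using iI form_a[OF iI(1), of S x] by (simp add: form_minus_right form_sym)
  also have "\<dots> \<ge> 0" using d posD[OF x(2)] by simp
  finally have 1: "euler S x (a i) \<ge> 0" .
  have "euler S (a i) x = form S (a i) (t (J \<inter> S) x)"
    using form_t_par[OF bip_orth[OF S], of J "a i" x] supported_a i iI by simp
  also have "\<dots> = - (inner (a i) (a i) / 2 * co (t (J \<inter> S) x) i)"
    using iI form_a[OF iI(1), of S] by simp
  finally have 2: "euler S (a i) x \<ge> 0 \<longleftrightarrow> co (t (J \<inter> S) x) i \<le> 0"
    using d by (simp add: mult_le_0_iff not_le[symmetric] del: inner_gt_zero_iff)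
  have "pos (t (J \<inter> S) x)" using pos_t[OF o x(1,2,4)] .
  then have "co (t (J \<inter> S) x) i \<ge> 0" by (rule posD)
  moreover have "x \<in> AP I" using x J AP_posI AP_mono by blast
  moreover have "a i \<in> AP I" using AP_aI iI by blast
  ultimately show ?thesis
    using 1 2 x i cpt_pos[OF pos_a[OF iI(1)] x(2)] by force
qed

text \<open>Positive roots that stay positive are handled by the Euler form, an exchange of
  \<open>a i\<close> and \<open>- a i\<close> by \<open>cpt_simple\<close>, and a fixed
  \<open>- a i\<close> by the fact that the reflections do not touch coordinate
  \<open>i\<close>.\<close>

lemma cpt_tau:
  assumes S: "bip S" and J: "J \<subseteq> I" and x: "x \<in> AP J" and y: "y \<in> AP J" and c: "cpt S x y"
  shows "cpt S (tau_par J S x) (tau_par J S y)"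
proof -
  have oS: "orth S" using S bip_orth by blast
  have o: "orth (J \<inter> S)" using oS orth_subset by blast
  have JS: "i \<in> I" if "i \<in> J \<inter> S \<or> i \<in> J - S" for i using that J by blast
  have tx: "tau_par J S x \<in> AP I" and ty: "tau_par J S y \<in> AP I"
    and xI: "x \<in> AP I" and yI: "y \<in> AP I"
    using tau_par_AP[OF J oS] x y AP_mono[OF J] by blast+
  have tco: "co (t (J \<inter> S) z) i = co z i" if "i \<in> J - S" for i z
    using that by (simp add: co_t[OF o])
  have ne: "x \<noteq> y" using c unfolding cpt_def by blast
  have co1: "co y i = 0" if "x = - a i" "i \<in> I" for i using c that unfolding cpt_def by blast
  have co2: "co x i = 0" if "y = - a i" "i \<in> I" for i using c that unfolding cpt_def by blast
  have neg: "cpt S (- a i) z \<longleftrightarrow> co z i = 0" if "i \<in> I" "z \<in> AP I" for i z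
    using cpt_neg that by blast
  have negAP: "- a i \<in> AP I" "a i \<in> AP I" if "i \<in> I" for i
    using AP_negI AP_aI that by blast+
  from J oS x show ?thesis
  proof (cases rule: tau_par_cases)
    case px: pos
    from J oS y show ?thesis
    proof (cases rule: tau_par_cases)
      case py: pos
      \<comment> \<open>The reflections cancel by involutivity, leaving the Euler form with its
        arguments exchanged. Compatibility is symmetric in the two values.\<close>
      have "euler S (t (J \<inter> S) u) (t (J \<inter> S) v) = euler S v u"
        if "supported J u" "supported J v" "supported J (t (J \<inter> S) u)" for u v
        using form_t_par[OF oS that(3), of "t (J \<inter> S) v"] form_t_par[OF oS that(2), of u]
        by (simp add: t_invol[OF o] form_sym)
      moreover have "t (J \<inter> S) x \<noteq> t (J \<inter> S) y" using ne t_invol[OF o] by metis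
      ultimately show ?thesis
        using c px py cpt_pos[OF px(2) py(2) xI yI] cpt_pos[OF px(6) py(6)] tx ty by auto
    next
      case (simple i)
      have "cpt S (a i) x" using c simple cpt_sym by blast
      then have "co (t (J \<inter> S) x) i = 0" using cpt_simple[OF S J simple(1) px(1-4)] by blast
      then show ?thesis using simple px tx neg JS cpt_sym by metis
    next
      case (neg i)
      then have "co (t (J \<inter> S) (t (J \<inter> S) x)) i = 0"
        using co2 JS t_invol[OF o] by metis
      then have "cpt S (a i) (t (J \<inter> S) x)"
        using cpt_simple[OF S J neg(1) px(7,6,8,9)] by blast
      then show ?thesis using neg px cpt_sym by metis
    next
      case (fixed i)
      then have "co (t (J \<inter> S) x) i = 0" using co2 JS tco by metis
      then show ?thesis using fixed px tx neg JS cpt_sym by metis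
    qed
  next
    case sx: (simple i)
    have iI: "i \<in> I" using JS sx by blast
    from J oS y show ?thesis
    proof (cases rule: tau_par_cases)
      case py: pos
      have "cpt S (a i) y" using c sx by blast
      then have "co (t (J \<inter> S) y) i = 0" using cpt_simple[OF S J sx(1) py(1-4)] by blast
      then show ?thesis using sx py ty neg JS by metis
    next
      case (simple j)
      then have "i \<noteq> j" using sx ne by blast
      then show ?thesis using sx simple neg iI JS negAP by (simp add: co_a)
    next
      case ny: (neg j)
      then have "co (a i) j = 0" using co2 sx JS by blast
      then have "i \<noteq> j" using iI by (auto simp: co_a)
      then show ?thesis using sx ny neg iI JS negAP by (simp add: co_a)
    next
      case (fixed j)
      then have "i \<noteq> j" using sx by blast
      then show ?thesis using sx fixed neg iI JS negAP by (simp add: co_a)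
    qed
  next
    case nx: (neg i)
    have iI: "i \<in> I" using JS nx by blast
    from J oS y show ?thesis
    proof (cases rule: tau_par_cases)
      case py: pos
      then have "co (t (J \<inter> S) (t (J \<inter> S) y)) i = 0"
        using co1 iI nx t_invol[OF o] by metis
      then have "cpt S (a i) (t (J \<inter> S) y)"
        using cpt_simple[OF S J nx(1) py(7,6,8,9)] by blast
      then show ?thesis using nx py by metis
    next
      case (simple j)
      then have "co (a j) i = 0" using co1 nx JS by blast
      then have "i \<noteq> j" using iI by (auto simp: co_a)
      then have "cpt S (- a j) (a i)" using simple neg iI JS negAP by (simp add: co_a)
      then show ?thesis using nx simple cpt_sym by metis
    next
      case ny: (neg j)
      have jI: "j \<in> I" using JS ny by blast
      have ij: "i \<noteq> j" using ne nx ny by blast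
      \<comment> \<open>Two negative simple roots of the reflected colour both become positive, so
        the Euler condition must be checked for them. Within one colour the form has no off-diagonal
        terms.\<close>
      have e: "euler S (a k) (a l) = 0" if "k \<in> J \<inter> S" "l \<in> J \<inter> S" "k \<noteq> l" for k l
      proof -
        have "euler S (a k) (a l) = form S (a k) (- a l)"
          using form_t_par[OF oS, of J "a k" "a l"] supported_a[of k J] that JS t_a[OF o that(2)]
          by simp
        moreover have "co (- a l) k = 0" using that JS by (simp add: co_a)
        ultimately show ?thesis using form_a[of k S "- a l"] that JS by (simp del: co_minus)
      qed
      then show ?thesis
        using cpt_pos[OF pos_a[OF iI] pos_a[OF jI]] negAP iI jI ij nx ny a_inj_iff
        by simp
    next
      case (fixed j)
      then have "i \<noteq> j" using nx by blast
      then have "cpt S (- a j) (a i)" using fixed neg iI JS negAP by (simp add: co_a)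
      then show ?thesis using nx fixed cpt_sym by metis
    qed
  next
    case fx: (fixed i)
    have iI: "i \<in> I" using JS fx by blast
    have y0: "co y i = 0" using co1 fx iI by blast
    from J oS y show ?thesis
    proof (cases rule: tau_par_cases)
      case py: pos
      then have "co (t (J \<inter> S) y) i = 0" using y0 fx tco by metis
      then show ?thesis using py fx ty neg iI by metis
    next
      case (simple j)
      then have "i \<noteq> j" using fx by blast
      then show ?thesis using fx simple neg iI JS negAP by (simp add: co_a)
    next
      case (neg j)
      then have "i \<noteq> j" using fx by blast
      then show ?thesis using fx neg cpt_neg iI JS negAP by (simp add: co_a)
    next
      case (fixed j)
      then show ?thesis using c fx by simp
    qed
  qed
qed

section \<open>Uniqueness of cluster expansions\<close>

text \<open>The orbit whose exit time from the positive orthant measures the inner inductions. The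
  colour is an argument, so that one step leads to the same kind of statement for the other
  colour.\<close>

primrec alt :: "nat \<Rightarrow> nat set \<Rightarrow> nat set \<Rightarrow> 'a \<Rightarrow> 'a" where
  "alt 0 J S x = x"
| "alt (Suc k) J S x = alt k J (I - S) (t (J \<inter> S) x)"

lemma bip_subset: "bip S \<Longrightarrow> S \<subseteq> I"
  unfolding bip_def orth_def by (elim conjE)

lemma bip_orth_par: "bip S \<Longrightarrow> orth (J \<inter> S)" "bip S \<Longrightarrow> orth (J \<inter> (I - S))"
  by (rule orth_subset[OF bip_orth Int_lower2], assumption)
    (rule orth_subset[OF bip_orth[OF bip_compl] Int_lower2])

lemma bip_compl_compl: "bip S \<Longrightarrow> I - (I - S) = S"
  using bip_subset by blast

text \<open>If w is fixed, then the two products move it by the same vector, which lies in the spans of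
  two disjoint sets of simple roots and hence vanishes. So w is orthogonal to all simple roots of J.\<close>
lemma fixed_eq_zero:
  assumes S: "bip S" and J: "J \<subseteq> I" and w: "supported J w"
    and fx: "t (J \<inter> (I - S)) (t (J \<inter> S) w) = w"
  shows "w = 0"
proof -
  have o: "orth (J \<inter> S)" "orth (J \<inter> (I - S))"
    by (rule bip_orth_par[OF S])+
  have eq: "t (J \<inter> S) w = t (J \<inter> (I - S)) w"
    using fx t_invol[OF o(2)] by metis
  have "inner (a i) w = 0" if i: "i \<in> J" for i
  proof -
    have iI: "i \<in> I" using i J by blast
    have "co (t (J \<inter> S) w) i = co (t (J \<inter> (I - S)) w) i" using eq by simp
    then have "inner (coroot (a i)) w = 0"
      using i iI by (cases "i \<in> S") (simp_all add: co_t[OF o(1)] co_t[OF o(2)])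
    then show ?thesis using a_nz[OF iI] by (simp add: inner_coroot)
  qed
  then have "\<And>i. co w i * inner (a i) w = 0"
    using supportedD[OF w] by auto
  then have "inner w w = 0" unfolding inner_expand[of w w] by (rule sum.neutral[OF ballI])
  then show ?thesis by simp
qed

text \<open>The sum of \<open>v\<close> over one period of the Coxeter element is a fixed vector,
  hence zero. Were all iterates positive, every summand would vanish, including \<open>v\<close>
  itself.\<close>

lemma alt_not_pos:
  assumes S: "bip S" and J: "J \<subseteq> I" and v: "supported J v" "v \<noteq> 0"
  obtains k where "\<not> pos (alt k J S v)"
proof -
  define c where "c x = t (J \<inter> (I - S)) (t (J \<inter> S) x)" for x
  have o: "orth (J \<inter> S)" "orth (J \<inter> (I - S))"
    by (rule bip_orth_par[OF S])+
  have lin: "linear c"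
    using linear_compose[OF linear_t linear_t] unfolding c_def comp_def .
  have inj: "inj c"
    unfolding c_def by (rule injI) (metis t_invol[OF o(1)] t_invol[OF o(2)])
  have im: "c ` \<Phi> \<subseteq> \<Phi>"
    unfolding c_def using t_Phi[OF o(1)] t_Phi[OF o(2)] by blast
  obtain N where N: "N > 0" "c ^^ N = id"
    using linear_finite_order[OF lin inj fin_Phi span_Phi im] .
  have alt: "alt (2 * k) J S x = (c ^^ k) x" for k x
    by (induction k arbitrary: x)
      (simp_all add: bip_compl_compl[OF S] c_def[symmetric] funpow_swap1)
  have supp: "supported J ((c ^^ k) v)" for k
  proof (induction k)
    case (Suc k)
    then show ?case
      unfolding funpow.simps comp_apply c_def
      by (intro supported_t o) auto
  qed (simp add: v)
  define w where "w = (\<Sum>k<N. (c ^^ k) v)"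
  have "c w = (\<Sum>k<N. (c ^^ Suc k) v)"
    unfolding w_def by (simp add: linear_sum[OF lin])
  also have "\<dots> = w"
    using sum.lessThan_Suc_shift[of "\<lambda>k. (c ^^ k) v" N] sum.lessThan_Suc[of "\<lambda>k. (c ^^ k) v" N] N(2)
    unfolding w_def by simp
  finally have "c w = w" .
  moreover have "supported J w"
    using supp unfolding w_def supported_def by (simp add: co_sum)
  ultimately have w0: "w = 0"
    using fixed_eq_zero[OF S J] unfolding c_def by blast
  have "\<exists>k. \<not> pos ((c ^^ k) v)"
  proof (rule ccontr)
    assume "\<not> (\<exists>k. \<not> pos ((c ^^ k) v))"
    then have nn: "\<And>k i. co ((c ^^ k) v) i \<ge> 0" unfolding pos_def by blast
    have "co v i = 0" for i
    proof -
      have "(\<Sum>k<N. co ((c ^^ k) v) i) = 0"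
        using w0 unfolding w_def by (metis co_sum co_zero)
      then have "\<forall>k\<in>{..<N}. co ((c ^^ k) v) i = 0"
        using nn sum_nonneg_eq_0_iff[of "{..<N}" "\<lambda>k. co ((c ^^ k) v) i"] by blast
      then show ?thesis using N(1) by force
    qed
    then show False using v(2) co_ext[of v 0] by simp
  qed
  then show thesis using that alt by metis
qed

text \<open>Coefficients of a point in a cone spanned by pairwise compatible elements. As
  \<open>m\<close> is total and vanishes off \<open>AP J\<close>, uniqueness, including equality of
  supports, is plain equality of functions.\<close>

definition expansion :: "nat set \<Rightarrow> nat set \<Rightarrow> ('a \<Rightarrow> real) \<Rightarrow> bool" where
  "expansion S J m \<longleftrightarrow> (\<forall>x. m x \<ge> 0) \<and> (\<forall>x. m x \<noteq> 0 \<longrightarrow> x \<in> AP J) \<and>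
     (\<forall>x y. m x \<noteq> 0 \<longrightarrow> m y \<noteq> 0 \<longrightarrow> x \<noteq> y \<longrightarrow> cpt S x y)"

definition val :: "nat set \<Rightarrow> ('a \<Rightarrow> real) \<Rightarrow> 'a" where
  "val J m = (\<Sum>x\<in>AP J. m x *\<^sub>R x)"

lemma expansion_compl: "bip S \<Longrightarrow> expansion (I - S) J m \<longleftrightarrow> expansion S J m"
  unfolding expansion_def by (simp add: cpt_compl)

lemma co_val: "co (val J m) i = (\<Sum>x\<in>AP J. m x * co x i)"
  unfolding val_def by (simp add: co_sum co_scale)

text \<open>If \<open>- a i\<close> occurs, every other term has coefficient 0 at
  \<open>a i\<close>, so the coordinate of the value is read off exactly. If it does not occur, no
  term is negative there. The value therefore determines which negative simple roots occur and how
  often.\<close>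

lemma expansion_neg_coeff:
  assumes J: "J \<subseteq> I" and m: "expansion S J m" and i: "i \<in> J"
  shows "m (- a i) = max 0 (- co (val J m) i)"
proof (cases "m (- a i) = 0")
  case True
  have "m x * co x i \<ge> 0" if "x \<in> AP J" for x
    using that
  proof (cases rule: AP_cases)
    case pos
    then show ?thesis using m posD unfolding expansion_def by simp
  next
    case (neg j)
    then show ?thesis using True J i by (cases "i = j") (auto simp: co_a subset_iff)
  qed
  then have "co (val J m) i \<ge> 0" unfolding co_val by (rule sum_nonneg)
  then show ?thesis using True by simp
next
  case False
  have iI: "i \<in> I" using i J by blast
  have "(\<Sum>x\<in>AP J. m x * co x i) = (\<Sum>x\<in>AP J. if x = - a i then - m (- a i) else 0)"
  proof (rule sum.cong, rule refl)
    fix x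
    show "m x * co x i = (if x = - a i then - m (- a i) else 0)"
    proof (cases "x = - a i \<or> m x = 0")
      case True
      then show ?thesis using False iI by (auto simp: co_a)
    next
      case nx: False
      then have "cpt S (- a i) x" using m False unfolding expansion_def by metis
      then have "co x i = 0" using iI unfolding cpt_def by blast
      then show ?thesis using nx by simp
    qed
  qed
  also have "\<dots> = - m (- a i)" using finite_AP[OF J] AP_negI[OF i] by simp
  finally have "co (val J m) i = - m (- a i)" unfolding co_val .
  moreover have "m (- a i) \<ge> 0" using m unfolding expansion_def by blast
  ultimately show ?thesis by simp
qed

lemma AP_split:
  assumes J: "J \<subseteq> I" and N: "N \<subseteq> J" and x: "x \<in> AP J" "\<forall>i\<in>N. co x i = 0"
  shows "x \<in> AP (J - N)"
  using x(1)
proof (cases rule: AP_cases)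
  case pos
  then show ?thesis using x(2) by (intro AP_posI) (auto simp: supported_def)
next
  case (neg i)
  then have "i \<notin> N" using x(2) J by (auto simp: co_a subset_iff)
  then show ?thesis using neg AP_negI by blast
qed

lemma AP_neg_disjoint: "J \<subseteq> I \<Longrightarrow> N \<subseteq> J \<Longrightarrow> AP (J - N) \<inter> (\<lambda>i. - a i) ` N = {}"
proof -
  assume J: "J \<subseteq> I" "N \<subseteq> J"
  have "- a i \<notin> AP (J - N)" if "i \<in> N" for i
  proof
    assume "- a i \<in> AP (J - N)"
    then have "co (- a i) i = 0" 
      using AP_supported[of "J - N"] supportedD J that by (metis DiffD2 Diff_subset subset_trans)
    then show False using that J by (auto simp: co_a subset_iff split: if_splits)
  qed
  then show ?thesis by blast
qed

text \<open>Compatibility with the negative simple roots in \<open>N\<close> removes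
  \<open>N\<close> from the support of all other terms.\<close>

lemma expansion_parabolic:
  assumes J: "J \<subseteq> I" and m: "expansion S J m" and N: "N = {i\<in>J. m (- a i) \<noteq> 0}"
  defines "m1 \<equiv> \<lambda>x. if x \<in> AP (J - N) then m x else 0"
  shows "expansion S (J - N) m1"
    and "val J m = val (J - N) m1 + (\<Sum>i\<in>N. m (- a i) *\<^sub>R (- a i))"
    and "m x \<noteq> 0 \<Longrightarrow> x \<in> AP (J - N) \<union> (\<lambda>i. - a i) ` N"
proof -
  show "expansion S (J - N) m1"
    using m unfolding expansion_def m1_def by auto
  have NJ: "N \<subseteq> J" using N by blast
  show supp: "x \<in> AP (J - N) \<union> (\<lambda>i. - a i) ` N" if x: "m x \<noteq> 0" for x
  proof (cases "x \<in> (\<lambda>i. - a i) ` N")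
    case False
    have "co x i = 0" if i: "i \<in> N" for i
    proof -
      have "x \<noteq> - a i" "m (- a i) \<noteq> 0" "i \<in> I" using False i N J by auto
      then have "cpt S (- a i) x" using m x unfolding expansion_def by metis
      then show ?thesis using \<open>i \<in> I\<close> unfolding cpt_def by blast
    qed
    then show ?thesis
      using AP_split[OF J NJ] m x unfolding expansion_def by blast
  qed simp
  have "AP (J - N) \<union> (\<lambda>i. - a i) ` N \<subseteq> AP J"
    using AP_mono[of "J - N" J] AP_negI NJ by blast
  then have "val J m = (\<Sum>x\<in>AP (J - N) \<union> (\<lambda>i. - a i) ` N. m x *\<^sub>R x)"
    unfolding val_def using supp finite_AP[OF J]
    by (intro sum.mono_neutral_right) auto
  also have "\<dots> = (\<Sum>x\<in>AP (J - N). m x *\<^sub>R x) + (\<Sum>x\<in>(\<lambda>i. - a i) ` N. m x *\<^sub>R x)"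
    using finite_subset[OF NJ] finite_subset[OF J fin_I] finite_AP[of "J - N"] J
    by (intro sum.union_disjoint AP_neg_disjoint[OF J NJ]) auto
  also have "(\<Sum>x\<in>AP (J - N). m x *\<^sub>R x) = val (J - N) m1"
    unfolding val_def m1_def by (rule sum.cong) auto
  also have "(\<Sum>x\<in>(\<lambda>i. - a i) ` N. m x *\<^sub>R x) = (\<Sum>i\<in>N. m (- a i) *\<^sub>R (- a i))"
    by (subst sum.reindex) (use NJ J a_inj in \<open>auto simp: inj_on_def subset_iff\<close>)
  finally show "val J m = val (J - N) m1 + (\<Sum>i\<in>N. m (- a i) *\<^sub>R (- a i))" .
qed

lemma tau_bij: "J \<subseteq> I \<Longrightarrow> orth S \<Longrightarrow> bij_betw (tau_par J S) (AP J) (AP J)"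
  by (rule bij_betw_byWitness[of _ "tau_par J S"]) (auto simp: tau_par_invol tau_par_AP)

lemma tau_par_pos:
  assumes "J \<subseteq> I" "pos x"
  shows "tau_par J S x = t (J \<inter> S) x"
  using assms not_pos_neg_a unfolding tau_par_def by auto

text \<open>A positive value excludes negative simple roots from the expansion, so
  \<open>tau_par\<close> acts on every term as the linear map \<open>t\<close>. As
  \<open>tau_par\<close> is its own inverse, precomposition moves the coefficients along.\<close>

lemma expansion_tau:
  assumes S: "bip S" and J: "J \<subseteq> I" and m: "expansion S J m" and p: "pos (val J m)"
  defines "m1 \<equiv> \<lambda>x. if x \<in> AP J then m (tau_par J S x) else 0"
  shows "expansion S J m1" and "val J m1 = t (J \<inter> S) (val J m)"
proof -
  have o: "orth S" using S bip_orth by blast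
  show "expansion S J m1"
    unfolding expansion_def
  proof (intro conjI allI impI)
    fix x y assume h: "m1 x \<noteq> 0" "m1 y \<noteq> 0" "x \<noteq> y"
    then have xy: "x \<in> AP J" "y \<in> AP J" "m (tau_par J S x) \<noteq> 0" "m (tau_par J S y) \<noteq> 0"
      unfolding m1_def by (auto split: if_splits)
    have "tau_par J S x \<noteq> tau_par J S y" using h(3) tau_par_invol[OF J o] xy by metis
    then have "cpt S (tau_par J S x) (tau_par J S y)" using m xy unfolding expansion_def by blast
    then show "cpt S x y"
      using cpt_tau[OF S J] tau_par_AP[OF J o] tau_par_invol[OF J o] xy by metis
  qed (use m in \<open>auto simp: m1_def expansion_def\<close>)
  have mp: "pos x" if "m x \<noteq> 0" for x
  proof -
    have "x \<in> AP J" using m that unfolding expansion_def by blast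
    then show ?thesis
    proof (cases rule: AP_cases)
      case (neg i)
      then have "m x = 0" using expansion_neg_coeff[OF J m neg(1)] posD[OF p, of i] by simp
      then show ?thesis using that by simp
    qed
  qed
  have "val J m1 = (\<Sum>x\<in>AP J. m (tau_par J S x) *\<^sub>R tau_par J S (tau_par J S x))"
    unfolding val_def m1_def by (rule sum.cong) (simp_all add: tau_par_invol[OF J o])
  also have "\<dots> = (\<Sum>x\<in>AP J. m x *\<^sub>R tau_par J S x)"
    using sum.reindex_bij_betw[OF tau_bij[OF J o], of "\<lambda>x. m x *\<^sub>R tau_par J S x"] .
  also have "\<dots> = (\<Sum>x\<in>AP J. m x *\<^sub>R t (J \<inter> S) x)"
    by (rule sum.cong) (use mp tau_par_pos[OF J] in force)+
  also have "\<dots> = t (J \<inter> S) (val J m)"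
    unfolding val_def by (simp add: t_sum t_scale)
  finally show "val J m1 = t (J \<inter> S) (val J m)" .
qed

text \<open>Treated separately because the zero vector never leaves the positive orthant. Value zero
  rules out negative simple roots, and a vanishing sum of nonnegative coordinates vanishes
  termwise.\<close>

lemma expansion_val_zero:
  assumes J: "J \<subseteq> I" and m: "expansion S J m" and z: "val J m = 0"
  shows "m = (\<lambda>_. 0)"
proof
  fix x
  show "m x = 0"
  proof (rule ccontr)
    assume x: "m x \<noteq> 0"
    have nn: "m y * co y i \<ge> 0" if "y \<in> AP J" for y i
      using that
    proof (cases rule: AP_cases)
      case pos
      then show ?thesis using m posD unfolding expansion_def by simp
    next
      case (neg j)
      then have "m y = 0" using expansion_neg_coeff[OF J m neg(1)] z by simp
      then show ?thesis by simp
    qed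
    have xA: "x \<in> AP J" using m x unfolding expansion_def by blast
    have "co x i = 0" for i
    proof -
      have "(\<Sum>y\<in>AP J. m y * co y i) = 0" using z co_val[of J m i] by simp
      then have "m x * co x i = 0"
        using nn xA sum_nonneg_eq_0_iff[OF finite_AP[OF J], of "\<lambda>y. m y * co y i"] by blast
      then show ?thesis using x by simp
    qed
    then have "x = 0" using co_ext[of x 0] by simp
    then show False using AP_Phi[OF J xA] zero_Phi by blast
  qed
qed

lemma supported_val: "J \<subseteq> I \<Longrightarrow> supported J (val J m)"
  unfolding supported_def co_val
  by (intro allI impI sum.neutral ballI) (simp add: supportedD[OF AP_supported])

text \<open>A negative coordinate of the common value exposes a negative simple root with the same
  coefficient in both expansions. Splitting off all such roots leaves expansions over a proper
  subset of \<open>J\<close>.\<close>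

lemma expansion_unique_step:
  assumes J: "J \<subseteq> I"
    and IH: "\<And>K m m'. K \<subset> J \<Longrightarrow> expansion S K m \<Longrightarrow> expansion S K m' \<Longrightarrow> val K m = val K m' \<Longrightarrow> m = m'"
    and m: "expansion S J m" "expansion S J m'" "val J m = val J m'" and np: "\<not> pos (val J m)"
  shows "m = m'"
proof -
  define N where "N = {i\<in>J. m (- a i) \<noteq> 0}"
  have mm: "m (- a i) = m' (- a i)" if "i \<in> J" for i
    using expansion_neg_coeff[OF J m(1) that] expansion_neg_coeff[OF J m(2) that] m(3) by simp
  then have N': "N = {i\<in>J. m' (- a i) \<noteq> 0}" unfolding N_def by auto
  have suppv: "supported J (val J m)" by (rule supported_val[OF J])
  obtain i where i: "co (val J m) i < 0" using np unfolding pos_def by (meson not_le)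
  then have "i \<in> J" using supportedD[OF suppv, of i] by force
  then have "i \<in> N" using i expansion_neg_coeff[OF J m(1), of i] unfolding N_def by simp
  then have psub: "J - N \<subset> J" using \<open>i \<in> J\<close> by blast
  note p = expansion_parabolic[OF J m(1) N_def] and p' = expansion_parabolic[OF J m(2) N']
  have "(\<Sum>i\<in>N. m (- a i) *\<^sub>R (- a i)) = (\<Sum>i\<in>N. m' (- a i) *\<^sub>R (- a i))"
    by (rule sum.cong) (use mm in \<open>auto simp: N_def\<close>)
  then have eq: "(\<lambda>x. if x \<in> AP (J - N) then m x else 0) = (\<lambda>x. if x \<in> AP (J - N) then m' x else 0)"
    using IH[OF psub p(1) p'(1)] p(2) p'(2) m(3) by simp
  show ?thesis
  proof
    fix x
    consider "x \<in> AP (J - N)" | i where "i \<in> N" "x = - a i"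
      | "x \<notin> AP (J - N) \<union> (\<lambda>i. - a i) ` N" by blast
    then show "m x = m' x"
    proof cases
      case 1
      then show ?thesis using fun_cong[OF eq, of x] by simp
    next
      case 2
      then show ?thesis using mm unfolding N_def by blast
    next
      case 3
      then show ?thesis using p(3) p'(3) by metis
    qed
  qed
qed

lemma expansion_unique:
  assumes "bip S" "J \<subseteq> I" "expansion S J m" "expansion S J m'" "val J m = val J m'"
  shows "m = m'"
proof -
  have "finite J" using assms(2) finite_subset fin_I by blast
  then show ?thesis using assms
  proof (induction J arbitrary: m m' rule: finite_psubset_induct)
    case (psubset J)
    note S = psubset.prems(1) and J = psubset.prems(2)
    have IH: "m = m'" if "K \<subset> J" "expansion T K m" "expansion T K m'" "val K m = val K m'"
      "T = S \<or> T = I - S" for K T m m'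
      using psubset.IH[OF that(1) S _ _ _ that(4)] that J by (auto simp: expansion_compl[OF S])
    have *: "m = m'" if "\<not> pos (alt k J T (val J m))" "expansion T J m" "expansion T J m'"
      "val J m = val J m'" "T = S \<or> T = I - S" for k T m m'
      using that
    proof (induction k arbitrary: T m m')
      case 0
      show ?case
        by (rule expansion_unique_step[OF J IH 0(2-4)]) (use 0 in auto)
    next
      case (Suc k)
      have T: "bip T" using Suc.prems(5) S bip_compl by blast
      have o: "orth T" using T bip_orth by blast
      show ?case
      proof (cases "pos (val J m)")
        case False
        show ?thesis
          by (rule expansion_unique_step[OF J IH Suc.prems(2-4) False]) (use Suc.prems in auto)
      next
        case True
        note e = expansion_tau[OF T J Suc.prems(2) True]
        have True': "pos (val J m')" using True Suc.prems(4) by simp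
        note e' = expansion_tau[OF T J Suc.prems(3) True']
        let ?m = "\<lambda>x. if x \<in> AP J then m (tau_par J T x) else 0"
        let ?m' = "\<lambda>x. if x \<in> AP J then m' (tau_par J T x) else 0"
        have eq: "?m = ?m'"
        proof (rule Suc.IH)
          show "\<not> pos (alt k J (I - T) (val J ?m))" using Suc.prems(1) e(2) by simp
          show "expansion (I - T) J ?m" "expansion (I - T) J ?m'"
            using e(1) e'(1) expansion_compl[OF T] by blast+
          show "val J ?m = val J ?m'" using e(2) e'(2) Suc.prems(4) by simp
          show "I - T = S \<or> I - T = I - S" using Suc.prems(5) bip_compl_compl[OF S] by blast
        qed
        show ?thesis
        proof
          fix x
          show "m x = m' x"
          proof (cases "x \<in> AP J")
            case True
            then show ?thesis
              using fun_cong[OF eq, of "tau_par J T x"] tau_par_AP[OF J o] tau_par_invol[OF J o]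
              by simp
          next
            case False
            then show ?thesis using Suc.prems(2,3) unfolding expansion_def by metis
          qed
        qed
      qed
    qed
    show ?case
    proof (cases "val J m = 0")
      case True
      then show ?thesis
        using expansion_val_zero[OF J] psubset.prems by metis
    next
      case False
      obtain k where "\<not> pos (alt k J S (val J m))"
        using alt_not_pos[OF S J supported_val[OF J] False] .
      from *[OF this psubset.prems(3-5)] show ?thesis by blast
    qed
  qed
qed

section \<open>Roots dual to a cluster\<close>

text \<open>Clusters of the parabolic subsystem. Maximality is put in the form that no single
  element can be added, which passes easily through bijections and restriction of
  \<open>J\<close>.\<close>

definition maximal_cpt :: "nat set \<Rightarrow> nat set \<Rightarrow> 'a set \<Rightarrow> bool" where
  "maximal_cpt S J C \<longleftrightarrow> C \<subseteq> AP J \<and> (\<forall>x\<in>C. \<forall>y\<in>C. x \<noteq> y \<longrightarrow> cpt S x y) \<and>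
     (\<forall>x\<in>AP J. x \<notin> C \<longrightarrow> (\<exists>y\<in>C. \<not> cpt S x y))"

text \<open>For \<open>J = I\<close> these are the inward facet normals of the cone over the image
  of \<open>C\<close> under \<open>L\<close>. The support condition makes their pairing with
  \<open>- a i\<close> vanish for \<open>i\<close> outside \<open>J\<close>, so that the family
  survives the passage to a larger \<open>J\<close>.\<close>

definition dual_roots :: "nat set \<Rightarrow> nat set \<Rightarrow> 'a set \<Rightarrow> ('a \<Rightarrow> 'a) \<Rightarrow> bool" where
  "dual_roots S J C \<gamma> \<longleftrightarrow> (\<forall>x\<in>C. \<gamma> x \<in> \<Phi> \<and> supported J (\<gamma> x) \<and> form S (\<gamma> x) x > 0 \<and>
     (\<forall>y\<in>C. y \<noteq> x \<longrightarrow> form S (\<gamma> x) y = 0))"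

lemma maximal_cpt_compl: "bip S \<Longrightarrow> maximal_cpt (I - S) J C \<longleftrightarrow> maximal_cpt S J C"
  unfolding maximal_cpt_def by (simp add: cpt_compl)

lemma dual_roots_compl: "dual_roots (I - S) J C \<gamma> \<Longrightarrow> dual_roots S J C (\<lambda>x. - \<gamma> x)"
  unfolding dual_roots_def by (simp add: form_compl form_minus_left neg_Phi)

lemma maximal_cpt_tau:
  assumes S: "bip S" and J: "J \<subseteq> I" and C: "maximal_cpt S J C"
  shows "maximal_cpt S J (tau_par J S ` C)"
proof -
  have o: "orth S" by (rule bip_orth[OF S])
  have CA: "C \<subseteq> AP J" using C unfolding maximal_cpt_def by (elim conjE)
  show ?thesis
    unfolding maximal_cpt_def
  proof (intro conjI ballI impI)
    show "tau_par J S ` C \<subseteq> AP J" using CA tau_par_AP[OF J o] by blast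
  next
    fix x y assume "x \<in> tau_par J S ` C" "y \<in> tau_par J S ` C" "x \<noteq> y"
    then obtain u v where uv: "u \<in> C" "v \<in> C" "x = tau_par J S u" "y = tau_par J S v" "u \<noteq> v"
      by blast
    then have "cpt S u v" using C unfolding maximal_cpt_def by blast
    then show "cpt S x y" using cpt_tau[OF S J] uv CA by blast
  next
    fix x assume x: "x \<in> AP J" "x \<notin> tau_par J S ` C"
    let ?u = "tau_par J S x"
    have u: "?u \<in> AP J" by (rule tau_par_AP[OF J o x(1)])
    have "x = tau_par J S ?u" using tau_par_invol[OF J o x(1)] by simp
    then have "?u \<notin> C" using x(2) by blast
    then obtain y where y: "y \<in> C" "\<not> cpt S ?u y" using C u unfolding maximal_cpt_def by blast
    have "\<not> cpt S x (tau_par J S y)"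
    proof
      assume "cpt S x (tau_par J S y)"
      then have "cpt S ?u (tau_par J S (tau_par J S y))"
        using cpt_tau[OF S J x(1)] tau_par_AP[OF J o] y CA by blast
      then show False using y CA tau_par_invol[OF J o] by (metis subsetD)
    qed
    then show "\<exists>y\<in>tau_par J S ` C. \<not> cpt S x y" using y by blast
  qed
qed

text \<open>The form is diagonal, so the dual of \<open>- a i\<close> is a multiple of
  \<open>a i\<close>. The sign depends on the colour: \<open>form S (a i) (- a i)\<close> is
  positive exactly for \<open>i\<close> in \<open>S\<close>.\<close>

lemma dual_roots_parabolic:
  assumes S: "bip S" and J: "J \<subseteq> I" and N: "N \<subseteq> J" and g: "dual_roots S (J - N) C \<gamma>"
    and C: "C \<subseteq> AP (J - N)"
  shows "dual_roots S J (C \<union> (\<lambda>i. - a i) ` N)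
    (\<lambda>x. if x \<in> C then \<gamma> x else if \<exists>i\<in>S. x = - a i then - x else x)"
proof -
  have JN: "J - N \<subseteq> I" using J by blast
  have coN: "co x i = 0" if "x \<in> C" "i \<in> N" for x i
    using AP_supported[OF JN, of x] C that supportedD[of "J - N" x i] by blast
  have nC: "- a i \<notin> C" if "i \<in> N" for i
    using AP_neg_disjoint[OF J N] C that by blast
  have rI: "i \<in> I" if "i \<in> N" for i using that J N by blast
  define \<delta> where "\<delta> = (\<lambda>x. if x \<in> C then \<gamma> x else if \<exists>i\<in>S. x = - a i then - x else x)"
  have dC: "\<delta> x = \<gamma> x" if "x \<in> C" for x using that unfolding \<delta>_def by simp
  have dN: "\<delta> (- a i) = (if i \<in> S then a i else - a i)" if i: "i \<in> N" for i
    using nC[OF i] a_inj_iff[OF rI[OF i]] bip_subset[OF S] unfolding \<delta>_def by auto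
  have fN: "form S (\<delta> (- a i)) y = - (inner (a i) (a i) / 2 * co y i)" if i: "i \<in> N" for i y
    using form_a[OF rI[OF i], of S y] by (cases "i \<in> S") (simp_all add: dN[OF i] form_minus_left)
  have f0: "form S (\<gamma> x) (- a i) = 0" if x: "x \<in> C" and i: "i \<in> N" for x i
  proof -
    have "supported (J - N) (\<gamma> x)" using g x unfolding dual_roots_def by blast
    then have "co (\<gamma> x) i = 0" using i supportedD[of "J - N" "\<gamma> x" i] by blast
    then show ?thesis
      using form_a[OF rI[OF i], of S "\<gamma> x"] by (simp add: form_minus_right form_sym[of S "\<gamma> x"])
  qed
  show ?thesis
    unfolding dual_roots_def \<delta>_def[symmetric]
  proof (intro ballI)
    fix x assume "x \<in> C \<union> (\<lambda>i. - a i) ` N"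
    then consider "x \<in> C" | i where "i \<in> N" "x = - a i" by blast
    then show "\<delta> x \<in> \<Phi> \<and> supported J (\<delta> x) \<and> form S (\<delta> x) x > 0 \<and>
      (\<forall>y\<in>C \<union> (\<lambda>i. - a i) ` N. y \<noteq> x \<longrightarrow> form S (\<delta> x) y = 0)"
    proof cases
      case 1
      then have "supported J (\<gamma> x)" using g unfolding dual_roots_def supported_def by blast
      then show ?thesis
        using 1 g f0 unfolding dual_roots_def by (auto simp: dC[OF 1])
    next
      case 2
      have "form S (\<delta> x) x = inner (a i) (a i) / 2"
        using fN[OF 2(1), of x] rI[OF 2(1)] by (simp add: 2(2) co_a)
      moreover have "inner (a i) (a i) > 0" using a_nz[OF rI[OF 2(1)]] by simp
      ultimately have "form S (\<delta> x) x > 0" by linarith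
      moreover have "\<delta> x \<in> \<Phi> \<and> supported J (\<delta> x)"
        using 2 dN rI a_Phi neg_Phi supported_a N by auto
      moreover have "form S (\<delta> x) y = 0" if y: "y \<in> C \<union> (\<lambda>i. - a i) ` N" "y \<noteq> x" for y
      proof -
        from y(1) consider "y \<in> C" | j where "j \<in> N" "y = - a j" by blast
        then have "co y i = 0"
        proof cases
          case (2 j)
          then have "i \<noteq> j" using y(2) \<open>x = - a i\<close> by blast
          then show ?thesis using 2 rI by (simp add: co_a)
        qed (use coN 2 in blast)
        then show ?thesis using fN[OF 2(1), of y] 2(2) by simp
      qed
      ultimately show ?thesis by blast
    qed
  qed
qed

text \<open>Maximality survives because anything supported off \<open>N\<close> is compatible with
  the removed negative simple roots, so an obstruction to adding it must come from the remaining
  part.\<close>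

lemma maximal_cpt_parabolic:
  assumes J: "J \<subseteq> I" and C: "maximal_cpt S J C" and N: "N = {i\<in>J. - a i \<in> C}"
  shows "maximal_cpt S (J - N) (C \<inter> AP (J - N))"
    and "C = C \<inter> AP (J - N) \<union> (\<lambda>i. - a i) ` N"
proof -
  have NJ: "N \<subseteq> J" and JN: "J - N \<subseteq> I" using N J by auto
  have CA: "C \<subseteq> AP J" using C unfolding maximal_cpt_def by (elim conjE)
  have sub: "x \<in> AP (J - N)" if x: "x \<in> C" "x \<notin> (\<lambda>i. - a i) ` N" for x
  proof (rule AP_split[OF J NJ])
    show "\<forall>i\<in>N. co x i = 0"
    proof
      fix i assume i: "i \<in> N"
      then have "- a i \<in> C" "x \<noteq> - a i" "i \<in> I" using N x J by auto
      then have "cpt S (- a i) x" using C x unfolding maximal_cpt_def by metis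
      then show "co x i = 0" using \<open>i \<in> I\<close> unfolding cpt_def by blast
    qed
  qed (use x CA in blast)
  show eq: "C = C \<inter> AP (J - N) \<union> (\<lambda>i. - a i) ` N"
  proof
    show "C \<subseteq> C \<inter> AP (J - N) \<union> (\<lambda>i. - a i) ` N" using sub by blast
    show "C \<inter> AP (J - N) \<union> (\<lambda>i. - a i) ` N \<subseteq> C" using N by blast
  qed
  show "maximal_cpt S (J - N) (C \<inter> AP (J - N))"
    unfolding maximal_cpt_def
  proof (intro conjI ballI impI)
    show "C \<inter> AP (J - N) \<subseteq> AP (J - N)" by blast
  next
    fix x y assume "x \<in> C \<inter> AP (J - N)" "y \<in> C \<inter> AP (J - N)" "x \<noteq> y"
    then show "cpt S x y" using C unfolding maximal_cpt_def by blast
  next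
    fix x assume x: "x \<in> AP (J - N)" "x \<notin> C \<inter> AP (J - N)"
    have "x \<in> AP J" using x AP_mono[of "J - N" J] by blast
    then obtain y where y: "y \<in> C" "\<not> cpt S x y" using C x unfolding maximal_cpt_def by blast
    have "y \<notin> (\<lambda>i. - a i) ` N"
    proof
      assume "y \<in> (\<lambda>i. - a i) ` N"
      then obtain i where i: "i \<in> N" "y = - a i" by blast
      have "co x i = 0" using AP_supported[OF JN x(1)] supportedD[of "J - N" x i] i by blast
      moreover have "i \<in> I" "x \<in> AP I" using i NJ J x AP_mono[OF JN] by blast+
      ultimately show False using y i cpt_neg cpt_sym by metis
    qed
    then show "\<exists>y\<in>C \<inter> AP (J - N). \<not> cpt S x y" using y sub by blast
  qed
qed

text \<open>Dual vectors are pulled back along the adjoint of \<open>t\<close>, and the minus sign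
  cancels the one in \<open>form_adjoint\<close>. The adjoint is again a product of reflections, so
  roots stay roots.\<close>

lemma dual_roots_tau:
  assumes S: "bip S" and J: "J \<subseteq> I" and C: "C \<subseteq> AP J" and g: "dual_roots S J (t (J \<inter> S) ` C) \<gamma>"
  shows "dual_roots S J C (\<lambda>x. - t (J \<inter> (I - S)) (\<gamma> (t (J \<inter> S) x)))"
  unfolding dual_roots_def
proof (intro ballI)
  fix x assume x: "x \<in> C"
  let ?g = "\<gamma> (t (J \<inter> S) x)"
  have o: "orth (J \<inter> S)" "orth (J \<inter> (I - S))" by (rule bip_orth_par[OF S])+
  have g': "?g \<in> \<Phi>" "supported J ?g" "form S ?g (t (J \<inter> S) x) > 0"
    "\<forall>y\<in>t (J \<inter> S) ` C. y \<noteq> t (J \<inter> S) x \<longrightarrow> form S ?g y = 0"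
    using g x unfolding dual_roots_def by blast+
  have f: "form S (- t (J \<inter> (I - S)) ?g) y = form S ?g (t (J \<inter> S) y)" if "y \<in> C" for y
    using form_adjoint[OF S g'(2), of y] AP_supported[OF J, of y] C that
    by (auto simp: form_minus_left)
  have "form S ?g (t (J \<inter> S) y) = 0" if "y \<in> C" "y \<noteq> x" for y
    using g'(4) that t_invol[OF o(1)] by (metis imageI)
  then show "- t (J \<inter> (I - S)) ?g \<in> \<Phi> \<and> supported J (- t (J \<inter> (I - S)) ?g) \<and>
      form S (- t (J \<inter> (I - S)) ?g) x > 0 \<and>
      (\<forall>y\<in>C. y \<noteq> x \<longrightarrow> form S (- t (J \<inter> (I - S)) ?g) y = 0)"
    using f x g' t_Phi[OF o(2)] neg_Phi supported_t[OF o(2)] by simp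
qed

lemma dual_roots_exist_step:
  assumes S: "bip S" and J: "J \<subseteq> I"
    and IH: "\<And>K C. K \<subset> J \<Longrightarrow> maximal_cpt S K C \<Longrightarrow> card C = card K \<and> (\<exists>\<gamma>. dual_roots S K C \<gamma>)"
    and C: "maximal_cpt S J C" and i: "i \<in> J" "- a i \<in> C"
  shows "card C = card J \<and> (\<exists>\<gamma>. dual_roots S J C \<gamma>)"
proof -
  define N where "N = {i\<in>J. - a i \<in> C}"
  have NJ: "N \<subseteq> J" and psub: "J - N \<subset> J" and JN: "J - N \<subseteq> I"
    using i J unfolding N_def by blast+
  note p = maximal_cpt_parabolic[OF J C N_def]
  let ?C = "C \<inter> AP (J - N)"
  obtain \<gamma> where g: "card ?C = card (J - N)" "dual_roots S (J - N) ?C \<gamma>"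
    using IH[OF psub p(1)] by blast
  have "dual_roots S J (?C \<union> (\<lambda>i. - a i) ` N)
    (\<lambda>x. if x \<in> ?C then \<gamma> x else if \<exists>i\<in>S. x = - a i then - x else x)"
    by (rule dual_roots_parabolic[OF S J NJ g(2)]) blast
  then have "\<exists>\<gamma>. dual_roots S J C \<gamma>" using p(2) by metis
  moreover have "card C = card J"
  proof -
    have fin: "finite J" "finite N"
      using finite_subset[OF J fin_I] finite_subset[OF NJ] by simp_all
    have "inj_on (\<lambda>i. - a i) N" using a_inj_iff NJ J by (auto simp: inj_on_def subset_iff)
    then have "card ((\<lambda>i. - a i) ` N) = card N" by (rule card_image)
    moreover have "card (?C \<union> (\<lambda>i. - a i) ` N) = card ?C + card ((\<lambda>i. - a i) ` N)"
      using AP_neg_disjoint[OF J NJ] fin finite_AP[OF JN] by (intro card_Un_disjoint) auto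
    ultimately show ?thesis
      using p(2) g(1) card_Diff_subset[OF fin(2) NJ] card_mono[OF fin(1) NJ] by simp
  qed
  ultimately show ?thesis by blast
qed

text \<open>The measure is the exit time of one chosen element of \<open>C\<close>. Until a negative
  simple root enters \<open>C\<close>, the map \<open>tau_par\<close> is linear on all of
  \<open>C\<close> and dual roots can be pulled back. Once one has entered, the rank drops.\<close>

lemma dual_roots_exist:
  assumes "bip S" "J \<subseteq> I" "maximal_cpt S J C"
  shows "card C = card J \<and> (\<exists>\<gamma>. dual_roots S J C \<gamma>)"
proof -
  have "finite J" using assms(2) finite_subset fin_I by blast
  then show ?thesis using assms
  proof (induction J arbitrary: C rule: finite_psubset_induct)
    case (psubset J)
    note S = psubset.prems(1) and J = psubset.prems(2)
    have IH: "card C = card K \<and> (\<exists>\<gamma>. dual_roots T K C \<gamma>)"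
      if K: "K \<subset> J" "maximal_cpt T K C" "T = S \<or> T = I - S" for K T C
    proof -
      have m: "maximal_cpt S K C" using K(2,3) maximal_cpt_compl[OF S] by auto
      have "K \<subseteq> I" using K(1) J by blast
      then obtain \<gamma> where g: "card C = card K" "dual_roots S K C \<gamma>"
        using psubset.IH[OF K(1) S _ m] by blast
      then have "dual_roots (I - (I - S)) K C \<gamma>" using bip_compl_compl[OF S] by simp
      then have "dual_roots (I - S) K C (\<lambda>x. - \<gamma> x)" by (rule dual_roots_compl)
      then show ?thesis using K(3) g by blast
    qed
    have *: "card C = card J \<and> (\<exists>\<gamma>. dual_roots T J C \<gamma>)"
      if "\<not> pos (alt k J T x)" "x \<in> C" "maximal_cpt T J C" "T = S \<or> T = I - S" for k T x C
      using that
    proof (induction k arbitrary: T x C)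
      case 0
      have "x \<in> AP J" using 0 unfolding maximal_cpt_def by blast
      then obtain i where i: "i \<in> J" "x = - a i"
        using 0(1) by (cases rule: AP_cases) auto
      have T: "bip T" using 0 S bip_compl by blast
      show ?case
        by (rule dual_roots_exist_step[OF T J IH 0(3) i(1)]) (use 0 i in auto)
    next
      case (Suc k)
      have T: "bip T" using Suc.prems(4) S bip_compl by blast
      show ?case
      proof (cases "\<exists>i\<in>J. - a i \<in> C")
        case True
        then obtain i where i: "i \<in> J" "- a i \<in> C" by blast
        show ?thesis
          by (rule dual_roots_exist_step[OF T J IH Suc.prems(3) i]) (use Suc.prems in auto)
      next
        case False
        have CA: "C \<subseteq> AP J" using Suc.prems(3) unfolding maximal_cpt_def by (elim conjE)
        have "tau_par J T y = t (J \<inter> T) y" if "y \<in> C" for y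
          using False that unfolding tau_par_def by auto
        then have im: "tau_par J T ` C = t (J \<inter> T) ` C" by (rule image_cong[OF HOL.refl])
        have "card (t (J \<inter> T) ` C) = card J \<and> (\<exists>\<gamma>. dual_roots (I - T) J (t (J \<inter> T) ` C) \<gamma>)"
        proof (rule Suc.IH)
          show "\<not> pos (alt k J (I - T) (t (J \<inter> T) x))" using Suc.prems(1) by simp
          show "t (J \<inter> T) x \<in> t (J \<inter> T) ` C" using Suc.prems(2) by blast
          show "maximal_cpt (I - T) J (t (J \<inter> T) ` C)"
            using maximal_cpt_tau[OF T J Suc.prems(3)] im maximal_cpt_compl[OF T] by simp
          show "I - T = S \<or> I - T = I - S" using Suc.prems(4) bip_compl_compl[OF S] by blast
        qed
        then obtain \<gamma> where g: "card (t (J \<inter> T) ` C) = card J"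
          "dual_roots (I - T) J (t (J \<inter> T) ` C) \<gamma>" by blast
        have "inj_on (t (J \<inter> T)) C"
          by (rule inj_on_inverseI[of _ "t (J \<inter> T)"]) (rule t_invol[OF bip_orth_par(1)[OF T]])
        then have "card C = card J" using g(1) by (simp add: card_image)
        then show ?thesis
          using dual_roots_tau[OF T J CA dual_roots_compl[OF g(2)]] by blast
      qed
    qed
    show ?case
    proof (cases "J = {}")
      case True
      have "C \<subseteq> AP J" using psubset.prems(3) unfolding maximal_cpt_def by (elim conjE)
      moreover have "AP J = {}"
      proof -
        have "x \<notin> \<Phi>" if "supported {} x" for x
        proof -
          have "x = 0" by (rule co_ext) (use supportedD[OF that] in simp)
          then show ?thesis using zero_Phi by blast
        qed
        then show ?thesis using True unfolding AP_def by auto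
      qed
      ultimately show ?thesis using True unfolding dual_roots_def by auto
    next
      case False
      then obtain i where "i \<in> J" by blast
      \<comment> \<open>An empty set is not maximal for nonempty \<open>J\<close>, since
        \<open>- a i\<close> could be added. This supplies an element on which to alternate.\<close>
      then have "C \<noteq> {}" using psubset.prems(3) AP_negI unfolding maximal_cpt_def by blast
      then obtain x where x: "x \<in> C" by blast
      then have "x \<in> AP J" using psubset.prems(3) unfolding maximal_cpt_def by blast
      then have "supported J x" "x \<noteq> 0" using AP_supported[OF J] AP_Phi[OF J] zero_Phi by blast+
      then obtain k where "\<not> pos (alt k J S x)" using alt_not_pos[OF S J] by blast
      from *[OF this x psubset.prems(3)] show ?thesis by blast
    qed
  qed
qed

section \<open>Agreement of the explicit relation with the axiomatic one\<close>

lemma cpt_tau_iff: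
  assumes S: "bip S" and J: "J \<subseteq> I" and x: "x \<in> AP J" and y: "y \<in> AP J"
  shows "cpt S x y \<longleftrightarrow> cpt S (tau_par J S x) (tau_par J S y)"
proof
  assume "cpt S (tau_par J S x) (tau_par J S y)"
  then have "cpt S (tau_par J S (tau_par J S x)) (tau_par J S (tau_par J S y))"
    using cpt_tau[OF S J] tau_par_AP[OF J bip_orth[OF S]] x y by blast
  then show "cpt S x y" using tau_par_invol[OF J bip_orth[OF S]] x y by simp
qed (rule cpt_tau[OF assms])

lemma almost_pos_eq: "almost_pos \<Phi> a = AP I"
proof -
  have "supported I x" for x unfolding supported_def using co_out by blast
  moreover have "pos x \<longleftrightarrow> (\<forall>i\<in>I. co x i \<ge> 0)" for x
    unfolding pos_def using co_out by (metis order.refl)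
  ultimately show ?thesis
    unfolding almost_pos_def pos_roots_def AP_def I_eq[symmetric] by simp
qed

lemma tau_eq: "bip S \<Longrightarrow> tau a S (I - S) x = tau_par I S x"
  using prod_refl_eq[OF bip_orth] bip_subset[of S]
  unfolding tau_def tau_par_def by (simp add: Int_absorb1)

lemma is_compat_cpt:
  assumes "bip S"
  shows "is_compat \<Phi> a (I - S) S (cpt S)"
  unfolding is_compat_def I_eq[symmetric] almost_pos_eq
proof (intro conjI ballI allI impI)
  fix x y
  have S': "bip (I - S)" by (rule bip_compl[OF assms])
  have t': "tau a (I - S) S x = tau_par I (I - S) x" for x
    using tau_eq[OF S'] bip_compl_compl[OF assms] by simp
  show "cpt S x y \<Longrightarrow> x \<in> AP I" "cpt S x y \<Longrightarrow> y \<in> AP I" unfolding cpt_def by blast+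
  show "cpt S x y \<Longrightarrow> cpt S y x" using cpt_sym by blast
  show "cpt S (- a i) y \<longleftrightarrow> co y i = 0" if "i \<in> I" "y \<in> AP I" for i y
    by (rule cpt_neg[OF that])
  show "cpt S x y \<longleftrightarrow> cpt S (tau a S (I - S) x) (tau a S (I - S) y)"
    if "x \<in> AP I" "y \<in> AP I" for x y
    unfolding tau_eq[OF assms] by (rule cpt_tau_iff[OF assms order.refl that])
  show "cpt S x y \<longleftrightarrow> cpt S (tau a (I - S) S x) (tau a (I - S) S y)"
    if "x \<in> AP I" "y \<in> AP I" for x y
    unfolding t' using cpt_tau_iff[OF S' order.refl that] by (simp add: cpt_compl[OF assms])
qed

text \<open>The alternating maps carry \<open>x\<close> to a negative simple root, where the axioms
  prescribe the relation. Invariance carries the answer back.\<close>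

lemma is_compat_unique:
  assumes S: "bip S" and R: "is_compat \<Phi> a (I - S) S R"
  shows "R = cpt S"
proof -
  have R1: "R x y \<Longrightarrow> x \<in> AP I \<and> y \<in> AP I" for x y
    using R unfolding is_compat_def almost_pos_eq by blast
  have R3: "R (- a i) y \<longleftrightarrow> co y i = 0" if "i \<in> I" "y \<in> AP I" for i y
    using R that unfolding is_compat_def almost_pos_eq I_eq by blast
  have R4: "R x y \<longleftrightarrow> R (tau_par I T x) (tau_par I T y)"
    if "x \<in> AP I" "y \<in> AP I" "T = S \<or> T = I - S" for x y T
  proof -
    have "R x y \<longleftrightarrow> R (tau a S (I - S) x) (tau a S (I - S) y)"
      "R x y \<longleftrightarrow> R (tau a (I - S) S x) (tau a (I - S) S y)"
      using R that unfolding is_compat_def almost_pos_eq by blast+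
    then show ?thesis
      using that(3) tau_eq[OF S] tau_eq[OF bip_compl[OF S]] bip_compl_compl[OF S] by auto
  qed
  have *: "R x y \<longleftrightarrow> cpt S x y"
    if "\<not> pos (alt k I T x)" "x \<in> AP I" "y \<in> AP I" "T = S \<or> T = I - S" for k T x y
    using that
  proof (induction k arbitrary: T x y)
    case 0
    from 0(2) obtain i where "i \<in> I" "x = - a i" using 0(1) by (cases rule: AP_cases) auto
    then show ?case using R3 cpt_neg 0(3) by simp
  next
    case (Suc k)
    have T: "bip T" using Suc.prems(4) S bip_compl by blast
    have c: "cpt T x y \<longleftrightarrow> cpt S x y" for x y
      using Suc.prems(4) cpt_compl[OF S] by auto
    from Suc.prems(2) show ?case
    proof (cases rule: AP_cases)
      case pos
      have tx: "tau_par I T x = t (I \<inter> T) x" by (rule tau_par_pos[OF order.refl pos(2)])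
      have "R (tau_par I T x) (tau_par I T y) \<longleftrightarrow> cpt S (tau_par I T x) (tau_par I T y)"
      proof (rule Suc.IH[of "I - T"])
        show "\<not> pos (alt k I (I - T) (tau_par I T x))" using Suc.prems(1) tx by simp
        show "I - T = S \<or> I - T = I - S" using Suc.prems(4) bip_compl_compl[OF S] by blast
      qed (use Suc.prems tau_par_AP[OF order.refl bip_orth[OF T]] in blast)+
      then show ?thesis
        using R4[OF Suc.prems(2-4)] cpt_tau_iff[OF T order.refl Suc.prems(2,3)] c by simp
    next
      case (neg i)
      then show ?thesis using R3 cpt_neg Suc.prems(3) by simp
    qed
  qed
  have "R x y \<longleftrightarrow> cpt S x y" for x y
  proof (cases "x \<in> AP I \<and> y \<in> AP I")
    case True
    then have "supported I x" "x \<noteq> 0"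
      using AP_supported[OF order.refl] AP_Phi[OF order.refl] zero_Phi by blast+
    then obtain k where "\<not> pos (alt k I S x)" using alt_not_pos[OF S order.refl] by blast
    then show ?thesis using * True by blast
  next
    case False
    then show ?thesis using R1 unfolding cpt_def by blast
  qed
  then show ?thesis by blast
qed

lemma compat_eq: "bip S \<Longrightarrow> compat \<Phi> a (I - S) S = cpt S"
  unfolding compat_def by (rule the_equality) (erule is_compat_cpt, erule is_compat_unique)

lemma cluster_eq:
  assumes "bip S"
  shows "cluster \<Phi> a (I - S) S C \<longleftrightarrow> maximal_cpt S I C"
proof
  assume c: "cluster \<Phi> a (I - S) S C"
  have p: "C \<subseteq> AP I" "\<forall>x\<in>C. \<forall>y\<in>C. x \<noteq> y \<longrightarrow> cpt S x y"
    using c unfolding cluster_def pairwise_compat_def compat_eq[OF assms] almost_pos_eq by auto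
  have "\<exists>y\<in>C. \<not> cpt S x y" if x: "x \<in> AP I" "x \<notin> C" for x
  proof (rule ccontr)
    assume "\<not> (\<exists>y\<in>C. \<not> cpt S x y)"
    then have "pairwise_compat \<Phi> a (I - S) S (insert x C)"
      using p x cpt_sym unfolding pairwise_compat_def compat_eq[OF assms] almost_pos_eq by auto
    then have "insert x C = C" using c unfolding cluster_def by blast
    then show False using x by blast
  qed
  then show "maximal_cpt S I C" using p unfolding maximal_cpt_def by blast
next
  assume m: "maximal_cpt S I C"
  show "cluster \<Phi> a (I - S) S C"
    unfolding cluster_def pairwise_compat_def compat_eq[OF assms] almost_pos_eq
  proof (intro conjI allI impI)
    fix D
    assume D: "(D \<subseteq> AP I \<and> (\<forall>x\<in>D. \<forall>y\<in>D. x \<noteq> y \<longrightarrow> cpt S x y)) \<and> C \<subseteq> D"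
    have m': "\<exists>y\<in>C. \<not> cpt S x y" if "x \<in> AP I" "x \<notin> C" for x
      using m that unfolding maximal_cpt_def by blast
    have "x \<in> C" if x: "x \<in> D" for x
    proof (rule ccontr)
      assume nx: "x \<notin> C"
      have "x \<in> AP I" using D x by (meson subsetD)
      from m'[OF this nx] obtain y where y: "y \<in> C" "\<not> cpt S x y" by (rule bexE)
      then have "y \<in> D" "x \<noteq> y" using D nx by auto
      then show False using D x y(2) by (elim conjE) simp
    qed
    then show "D = C" using D by blast
  qed (use m in \<open>auto simp: maximal_cpt_def\<close>)
qed

end

section \<open>Simplicial cones\<close>

lemma span_cone_memI: "x \<in> S \<Longrightarrow> finite S \<Longrightarrow> r \<ge> 0 \<Longrightarrow> r *\<^sub>R x \<in> span_cone S"
proof -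
  assume h: "x \<in> S" "finite S" "r \<ge> 0"
  have "r *\<^sub>R x = (\<Sum>y\<in>S. (if y = x then r else 0) *\<^sub>R y)"
    using h by (simp add: if_distrib[of "\<lambda>r. r *\<^sub>R _"] cong: if_cong)
  then show ?thesis unfolding span_cone_def using h by (auto intro!: exI[of _ "\<lambda>y. if y = x then r else 0"])
qed

lemma zero_span_cone: "0 \<in> span_cone S"
  unfolding span_cone_def by (auto intro!: exI[of _ "\<lambda>_. 0"])

lemma cone_span_cone: "cone (span_cone S)"
  unfolding cone_def
proof (intro ballI allI impI)
  fix y :: 'a and r :: real
  assume "y \<in> span_cone S" "r \<ge> 0"
  then obtain c where "\<forall>x\<in>S. c x \<ge> 0" "y = (\<Sum>x\<in>S. c x *\<^sub>R x)" unfolding span_cone_def by blast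
  then have "\<forall>x\<in>S. r * c x \<ge> 0" "r *\<^sub>R y = (\<Sum>x\<in>S. (r * c x) *\<^sub>R x)"
    using \<open>r \<ge> 0\<close> by (auto simp: scaleR_sum_right)
  then show "r *\<^sub>R y \<in> span_cone S"
    unfolding span_cone_def by (intro CollectI exI[of _ "\<lambda>x. r * c x"] conjI)
qed

lemma linear_image_span_cone:
  assumes "linear f" "inj f"
  shows "f ` span_cone S = span_cone (f ` S)"
proof
  have sum: "f (\<Sum>x\<in>S. c x *\<^sub>R x) = (\<Sum>x\<in>S. c x *\<^sub>R f x)" for c
    using assms by (simp add: linear_sum linear_scale)
  have re: "(\<Sum>y\<in>f ` S. c y *\<^sub>R y) = (\<Sum>x\<in>S. c (f x) *\<^sub>R f x)" for c
    using sum.reindex[OF inj_on_subset[OF assms(2) subset_UNIV], of "\<lambda>y. c y *\<^sub>R y" S]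
    by (simp add: comp_def)
  show "f ` span_cone S \<subseteq> span_cone (f ` S)"
  proof
    fix y assume "y \<in> f ` span_cone S"
    then obtain c where c: "\<forall>x\<in>S. c x \<ge> 0" "y = f (\<Sum>x\<in>S. c x *\<^sub>R x)"
      unfolding span_cone_def by blast
    have "y = (\<Sum>y\<in>f ` S. c (inv f y) *\<^sub>R y)"
      using c(2) by (simp add: sum re inv_f_f[OF assms(2)])
    moreover have "\<forall>y\<in>f ` S. c (inv f y) \<ge> 0" using c(1) by (simp add: inv_f_f[OF assms(2)])
    ultimately show "y \<in> span_cone (f ` S)"
      unfolding span_cone_def by (intro CollectI exI[of _ "\<lambda>y. c (inv f y)"] conjI)
  qed
  show "span_cone (f ` S) \<subseteq> f ` span_cone S"
  proof
    fix y assume "y \<in> span_cone (f ` S)"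
    then obtain c where c: "\<forall>y\<in>f ` S. c y \<ge> 0" "y = (\<Sum>y\<in>f ` S. c y *\<^sub>R y)"
      unfolding span_cone_def by blast
    have "y = f (\<Sum>x\<in>S. c (f x) *\<^sub>R x)" using c(2) by (simp add: sum re)
    moreover have "(\<Sum>x\<in>S. c (f x) *\<^sub>R x) \<in> span_cone S"
      unfolding span_cone_def using c(1) by (intro CollectI exI[of _ "\<lambda>x. c (f x)"] conjI) auto
    ultimately show "y \<in> f ` span_cone S" by blast
  qed
qed

section \<open>Faces of finitely generated cones\<close>

lemma face_of_cone_scale:
  assumes K: "cone K" and G: "G face_of K" and x: "x \<in> G" and r: "r \<ge> 0"
  shows "r *\<^sub>R x \<in> G"
proof (cases "x = 0 \<or> r = 1")
  case False
  have xK: "x \<in> K" using G x face_of_imp_subset by blast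
  \<comment> \<open>A multiple on the other side of 1 from \<open>r\<close>, so that
    \<open>x\<close> lies strictly between \<open>r *\<^sub>R x\<close> and
    \<open>s *\<^sub>R x\<close>. The weight \<open>u\<close> below solves
    \<open>(1 - u) * r + u * s = 1\<close>.\<close>
  define s where "s = (if r < 1 then 2 else 0 :: real)"
  have rK: "r *\<^sub>R x \<in> K" "s *\<^sub>R x \<in> K" using K xK r unfolding cone_def s_def by auto
  have sr: "s \<noteq> r" using r unfolding s_def by auto
  define u where "u = (1 - r) / (s - r)"
  have u: "0 < u" "u < 1" using False r unfolding u_def s_def by (auto simp: field_simps)
  have "(1 - u) * r + u * s = r + u * (s - r)" by (simp add: algebra_simps)
  also have "\<dots> = 1" using sr unfolding u_def by simp
  finally have "(1 - u) *\<^sub>R (r *\<^sub>R x) + u *\<^sub>R (s *\<^sub>R x) = x"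
    by (simp flip: scaleR_add_left)
  moreover have "r *\<^sub>R x \<noteq> s *\<^sub>R x" using False sr by simp
  ultimately have "x \<in> open_segment (r *\<^sub>R x) (s *\<^sub>R x)"
    using u unfolding in_segment by (intro conjI exI[of _ u]) auto
  then show ?thesis using G rK x unfolding face_of_def by blast
qed (use x in auto)

text \<open>The sum is the midpoint of the doubled summands, which lie in the cone.\<close>

lemma face_of_cone_sum:
  assumes K: "cone K" and G: "G face_of K" and x: "x \<in> K" "y \<in> K" "x + y \<in> G"
  shows "x \<in> G"
proof -
  have "2 *\<^sub>R x \<in> K" "2 *\<^sub>R y \<in> K" using K x unfolding cone_def by auto
  have *: "2 *\<^sub>R x \<in> G"
  proof (cases "x = y")
    case True
    then show ?thesis using x(3) by (simp add: scaleR_2)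
  next
    case False
    have "x + y \<in> open_segment (2 *\<^sub>R x) (2 *\<^sub>R y)"
      using False unfolding in_segment by (intro conjI exI[of _ "1/2"]) auto
    then show ?thesis using G x \<open>2 *\<^sub>R x \<in> K\<close> \<open>2 *\<^sub>R y \<in> K\<close> unfolding face_of_def by blast
  qed
  show ?thesis using face_of_cone_scale[OF K G *, of "1/2"] by simp
qed

text \<open>Splitting a point of the face into one term and the remaining sum shows that each
  generator with nonzero coefficient lies in the face.\<close>

lemma face_of_span_cone:
  fixes S :: "'a::euclidean_space set"
  assumes fin: "finite S" and G: "G face_of span_cone S" "G \<noteq> {}"
  shows "G = span_cone (S \<inter> G)"
proof
  have cG: "r *\<^sub>R x \<in> G" if "x \<in> G" "r \<ge> 0" for r x
    using face_of_cone_scale[OF cone_span_cone G(1) that] .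
  have GS: "G \<subseteq> span_cone S" using G face_of_imp_subset by blast
  have aG: "x + y \<in> G" if "x \<in> G" "y \<in> G" for x y
  proof -
    have "convex G" using G unfolding face_of_def by blast
    then have "(1/2) *\<^sub>R x + (1/2) *\<^sub>R y \<in> G" using that by (intro convexD) auto
    then show ?thesis using cG[of _ 2] by (fastforce simp: scaleR_add_right)
  qed
  have 0: "0 \<in> G" using G(2) cG[of _ 0] by auto
  show "G \<subseteq> span_cone (S \<inter> G)"
  proof
    fix v assume v: "v \<in> G"
    then obtain c where c: "\<forall>x\<in>S. c x \<ge> 0" "v = (\<Sum>x\<in>S. c x *\<^sub>R x)"
      using GS unfolding span_cone_def by blast
    have inG: "x \<in> G" if x: "x \<in> S" "c x \<noteq> 0" for x
    proof -
      have "(\<Sum>y\<in>S - {x}. c y *\<^sub>R y) = (\<Sum>y\<in>S. (if y = x then 0 else c y) *\<^sub>R y)"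
        using fin by (simp add: sum.remove[OF fin x(1)])
      moreover have "(\<Sum>y\<in>S. (if y = x then 0 else c y) *\<^sub>R y) \<in> span_cone S"
        unfolding span_cone_def using c(1) by (intro CollectI exI[of _ "\<lambda>y. if y = x then 0 else c y"]) auto
      ultimately have r: "(\<Sum>y\<in>S - {x}. c y *\<^sub>R y) \<in> span_cone S" by simp
      have "c x *\<^sub>R x \<in> span_cone S" using span_cone_memI x fin c(1) by blast
      moreover have "c x *\<^sub>R x + (\<Sum>y\<in>S - {x}. c y *\<^sub>R y) \<in> G"
        using v c(2) sum.remove[OF fin x(1)] by metis
      ultimately have "c x *\<^sub>R x \<in> G" using face_of_cone_sum[OF cone_span_cone G(1)] r by blast
      then show ?thesis using cG[of "c x *\<^sub>R x" "1 / c x"] c(1) x by simp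
    qed
    have "v = (\<Sum>x\<in>S \<inter> G. c x *\<^sub>R x)"
      unfolding c(2) by (rule sum.mono_neutral_right) (use fin inG in auto)
    then show "v \<in> span_cone (S \<inter> G)" unfolding span_cone_def using c(1) by auto
  qed
  show "span_cone (S \<inter> G) \<subseteq> G"
  proof
    fix v assume "v \<in> span_cone (S \<inter> G)"
    then obtain c where c: "\<forall>x\<in>S \<inter> G. c x \<ge> 0" "v = (\<Sum>x\<in>S \<inter> G. c x *\<^sub>R x)"
      unfolding span_cone_def by blast
    have "(\<Sum>x\<in>T. c x *\<^sub>R x) \<in> G" if "T \<subseteq> S \<inter> G" for T
      using finite_subset[OF that] fin that
    proof (induction T rule: infinite_finite_induct)
      case (insert x T)
      then show ?case using aG cG c(1) by simp
    qed (use 0 in auto)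
    then show "v \<in> G" using c(2) by blast
  qed
qed

text \<open>Dual only up to positive factors, which leaves the freedom to choose roots as dual
  vectors.\<close>

definition dual_basis :: "'a::euclidean_space set \<Rightarrow> ('a \<Rightarrow> 'a) \<Rightarrow> bool" where
  "dual_basis B \<delta> \<longleftrightarrow> finite B \<and> card B = DIM('a) \<and>
     (\<forall>x\<in>B. inner (\<delta> x) x > 0 \<and> (\<forall>y\<in>B. y \<noteq> x \<longrightarrow> inner (\<delta> x) y = 0))"

lemma dual_basis_comb:
  assumes "dual_basis B \<delta>" "S \<subseteq> B" "x \<in> B"
  shows "inner (\<delta> x) (\<Sum>y\<in>S. c y *\<^sub>R y) = (if x \<in> S then c x * inner (\<delta> x) x else 0)"
proof -
  have "finite S" using assms finite_subset unfolding dual_basis_def by blast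
  have "inner (\<delta> x) (\<Sum>y\<in>S. c y *\<^sub>R y) = (\<Sum>y\<in>S. if y = x then c x * inner (\<delta> x) x else 0)"
    unfolding inner_sum_right
    by (rule sum.cong) (use assms in \<open>auto simp: dual_basis_def\<close>)
  then show ?thesis using \<open>finite S\<close> by simp
qed

lemma dual_basis_span:
  fixes B :: "'a::euclidean_space set"
  assumes "dual_basis B \<delta>"
  shows "span B = UNIV"
proof -
  have fin: "finite B" "card B = DIM('a)" using assms unfolding dual_basis_def by auto
  have "independent B"
    unfolding independent_explicit
  proof (intro conjI allI impI ballI)
    fix c x assume h: "(\<Sum>v\<in>B. c v *\<^sub>R v) = 0" "x \<in> B"
    have "c x * inner (\<delta> x) x = 0"
      using dual_basis_comb[OF assms order.refl h(2), of c] h by simp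
    moreover have "inner (\<delta> x) x > 0" using assms h(2) unfolding dual_basis_def by blast
    ultimately show "c x = 0" by simp
  qed (rule fin)
  then show ?thesis using card_ge_dim_independent[of B UNIV] fin by auto
qed

text \<open>Pairing with \<open>\<delta> x\<close> isolates the coefficient at \<open>x\<close> up
  to a positive factor, so sign conditions on coefficients become linear inequalities and
  equations.\<close>

lemma dual_basis_span_cone:
  assumes d: "dual_basis B \<delta>" and S: "S \<subseteq> B"
  shows "span_cone S = {v. \<forall>x\<in>B. inner (\<delta> x) v \<ge> 0 \<and> (x \<notin> S \<longrightarrow> inner (\<delta> x) v = 0)}" (is "_ = ?H")
proof
  have pos: "inner (\<delta> x) x > 0" if "x \<in> B" for x using d that unfolding dual_basis_def by blast
  have fin: "finite B" using d unfolding dual_basis_def by blast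
  show "span_cone S \<subseteq> ?H"
  proof
    fix v assume "v \<in> span_cone S"
    then obtain c where c: "\<forall>x\<in>S. c x \<ge> 0" "v = (\<Sum>x\<in>S. c x *\<^sub>R x)" unfolding span_cone_def by blast
    show "v \<in> ?H"
      using c(1) pos by (auto simp: c(2) dual_basis_comb[OF d S] less_imp_le)
  qed
  show "?H \<subseteq> span_cone S"
  proof
    fix v assume v: "v \<in> ?H"
    have "v \<in> span B" by (simp add: dual_basis_span[OF d])
    then obtain c where c: "v = (\<Sum>x\<in>B. c x *\<^sub>R x)" unfolding span_finite[OF fin] by auto
    have e: "inner (\<delta> x) v = c x * inner (\<delta> x) x" if "x \<in> B" for x
      using dual_basis_comb[OF d order.refl that, of c] c that by simp
    have "v = (\<Sum>x\<in>S. c x *\<^sub>R x)"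
      unfolding c
    proof (rule sum.mono_neutral_right[OF fin S], intro ballI)
      fix x assume x: "x \<in> B - S"
      then have "c x * inner (\<delta> x) x = 0" using v e by auto
      then show "c x *\<^sub>R x = 0" using pos[of x] x by auto
    qed
    moreover have "\<forall>x\<in>S. c x \<ge> 0"
    proof
      fix x assume "x \<in> S"
      then have x: "x \<in> B" using S by blast
      then have "c x * inner (\<delta> x) x \<ge> 0" using v e by auto
      then show "c x \<ge> 0" using pos[OF x] by (simp add: zero_le_mult_iff)
    qed
    ultimately show "v \<in> span_cone S" unfolding span_cone_def by blast
  qed
qed

lemma dual_basis_polyhedron:
  assumes d: "dual_basis B \<delta>" and S: "S \<subseteq> B"
  shows "polyhedron (span_cone S)"
proof -
  have fin: "finite B" using d unfolding dual_basis_def by blast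
  have "span_cone S = (\<Inter>x\<in>B. {v. inner (\<delta> x) v \<ge> 0}) \<inter> (\<Inter>x\<in>B - S. {v. inner (\<delta> x) v = 0})"
    unfolding dual_basis_span_cone[OF d S] by auto
  also have "polyhedron \<dots>"
    using fin by (intro polyhedron_Int polyhedron_Inter)
      (auto intro: polyhedron_halfspace_ge polyhedron_hyperplane)
  finally show ?thesis .
qed

lemma dual_basis_face:
  assumes d: "dual_basis B \<delta>" and S: "S \<subseteq> B" and T: "T \<subseteq> S"
  shows "span_cone T face_of span_cone S"
proof -
  have fin: "finite B" using d unfolding dual_basis_def by blast
  have TB: "T \<subseteq> B" using S T by blast
  \<comment> \<open>On the cone each summand is nonnegative, so this functional vanishes exactly
    where all coefficients of the dropped generators do: it supports the face.\<close>
  let ?w = "\<Sum>x\<in>S - T. \<delta> x"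
  have w: "inner ?w v = (\<Sum>x\<in>S - T. inner (\<delta> x) v)" for v by (simp add: inner_sum_left)
  have ge: "inner (\<delta> x) v \<ge> 0" if "v \<in> span_cone S" "x \<in> S - T" for x v
    using that S unfolding dual_basis_span_cone[OF d S] by auto
  have "span_cone T = span_cone S \<inter> {v. inner ?w v = 0}"
  proof -
    have "inner ?w v = 0 \<longleftrightarrow> (\<forall>x\<in>S - T. inner (\<delta> x) v = 0)" if "v \<in> span_cone S" for v
      unfolding w using ge[OF that] finite_subset[OF S fin]
      by (intro sum_nonneg_eq_0_iff) auto
    then have "span_cone S \<inter> {v. inner ?w v = 0} = span_cone S \<inter> {v. \<forall>x\<in>S - T. inner (\<delta> x) v = 0}"
      by blast
    also have "\<dots> = span_cone T"
      unfolding dual_basis_span_cone[OF d S] dual_basis_span_cone[OF d TB] using S T by blast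
    finally show ?thesis by simp
  qed
  also have "\<dots> face_of span_cone S"
  proof (rule face_of_Int_supporting_hyperplane_ge)
    show "convex (span_cone S)" using dual_basis_polyhedron[OF d S] polyhedron_imp_convex by blast
    show "inner ?w v \<ge> 0" if "v \<in> span_cone S" for v
      unfolding w using ge[OF that] by (rule sum_nonneg)
  qed
  finally show ?thesis .
qed

section \<open>The image fan and the Coxeter fan\<close>

context simple_roots
begin

section \<open>The linear map as a bilinear pairing\<close>

lemma linear_functional_inner:
  fixes f :: "'a \<Rightarrow> real"
  assumes "linear f"
  shows "\<exists>w. \<forall>x. inner x w = f x"
  using adjoint_works[OF assms, of _ 1] by (intro exI[of _ "adjoint f 1"]) simp

lemma fund_weight_works:
  assumes j: "j \<in> I" and i: "i \<in> I"
  shows "inner (coroot (a i)) (fund_weight a j) = (if i = j then 1 else 0)"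
proof -
  let ?P = "\<lambda>w. \<forall>i\<in>I. inner (coroot (a i)) w = (if i = j then 1 else 0)"
  \<comment> \<open>The functional that the fundamental weight represents. Half the squared length
    cancels the normalisation of the coroot.\<close>
  have "linear (\<lambda>x. inner (a j) (a j) / 2 * co x j)"
    by (rule linearI) (simp_all add: co_add co_scale algebra_simps)
  then obtain w where w: "\<And>x. inner x w = inner (a j) (a j) / 2 * co x j"
    using linear_functional_inner by blast
  have "?P w"
    unfolding inner_coroot unfolding w using a_nz[OF j] by (simp add: co_a)
  moreover have "u = w" if u: "?P u" for u
  proof -
    have "inner (a i) u = inner (a i) w" if i: "i \<in> I" for i
    proof -
      have "inner (coroot (a i)) u = inner (coroot (a i)) w" using u \<open>?P w\<close> i by simp
      then show ?thesis using a_nz[OF i] by (simp add: inner_coroot)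
    qed
    then have "inner x u = inner x w" for x
      unfolding inner_expand[of x] by (intro sum.cong) auto
    from this[of "u - w"] have "inner (u - w) (u - w) = 0" by (simp only: inner_diff_right)
    then show ?thesis by simp
  qed
  ultimately have "?P (fund_weight a j)"
    unfolding fund_weight_def I_eq[symmetric] by (rule theI)
  then show ?thesis using i by blast
qed

lemma inner_L:
  assumes L: "linear L" "\<And>i. i \<in> I \<Longrightarrow> L (a i) = (if i \<in> S then - 1 else 1) *\<^sub>R fund_weight a i"
  shows "inner x (L y) = form S x y"
proof -
  have *: "inner (a i) (L y) = (if i \<in> S then - 1 else 1) * (inner (a i) (a i) / 2) * co y i"
    if i: "i \<in> I" for i
  proof -
    have "L y = (\<Sum>j\<in>I. co y j *\<^sub>R L (a j))"
      by (subst co_expand[of y]) (simp add: linear_sum[OF L(1)] linear_scale[OF L(1)])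
    then have "inner (coroot (a i)) (L y) =
        (\<Sum>j\<in>I. co y j * ((if j \<in> S then - 1 else 1) * inner (coroot (a i)) (fund_weight a j)))"
      using L(2) by (simp add: inner_sum_right mult.assoc)
    also have "\<dots> = (\<Sum>j\<in>I. if j = i then (if i \<in> S then - 1 else 1) * co y i else 0)"
      by (rule sum.cong) (auto simp: fund_weight_works i)
    also have "\<dots> = (if i \<in> S then - 1 else 1) * co y i" using i by simp
    finally show ?thesis using a_nz[OF i] by (simp add: inner_coroot field_simps)
  qed
  show ?thesis
    unfolding inner_expand[of x] form_def by (rule sum.cong) (simp_all add: *)
qed

lemma inj_L:
  assumes L: "linear L" "\<And>i. i \<in> I \<Longrightarrow> L (a i) = (if i \<in> S then - 1 else 1) *\<^sub>R fund_weight a i"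
  shows "inj L"
proof -
  have "x = 0" if "L x = 0" for x
  proof (rule co_ext)
    fix i assume i: "i \<in> I"
    have "form S (a i) x = 0" using inner_L[OF L, of "a i" x] that by simp
    then show "co x i = co 0 i" using form_a[OF i, of S x] a_nz[OF i] by (simp split: if_splits)
  qed
  then show ?thesis using linear_injective_0[OF L(1)] by blast
qed

text \<open>The height functional works: the coefficients of a root share one sign and are not all
  zero.\<close>

lemma regular_vector: "\<exists>\<rho>. \<forall>\<beta>\<in>\<Phi>. inner \<beta> \<rho> \<noteq> 0"
proof -
  have "linear (\<lambda>x. \<Sum>i\<in>I. co x i)"
    by (rule linearI) (simp_all add: co_add co_scale sum.distrib sum_distrib_left)
  then obtain w where w: "\<And>x. inner x w = (\<Sum>i\<in>I. co x i)"
    using linear_functional_inner by blast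
  have "inner \<beta> w \<noteq> 0" if b: "\<beta> \<in> \<Phi>" for \<beta>
  proof
    assume "inner \<beta> w = 0"
    then have s: "(\<Sum>i\<in>I. co \<beta> i) = 0" "(\<Sum>i\<in>I. - co \<beta> i) = 0" using w by (simp_all add: sum_negf)
    have "\<forall>i\<in>I. co \<beta> i = 0"
    proof (cases "\<forall>i. co \<beta> i \<ge> 0")
      case True
      then show ?thesis using s(1) sum_nonneg_eq_0_iff[OF fin_I, of "co \<beta>"] by blast
    next
      case False
      then have "\<forall>i. - co \<beta> i \<ge> 0" using root_sign[OF b] by auto
      then have "\<forall>i\<in>I. - co \<beta> i = 0"
        using s(2) sum_nonneg_eq_0_iff[OF fin_I, of "\<lambda>i. - co \<beta> i"] by blast
      then show ?thesis by simp
    qed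
    then have "\<beta> = 0" using co_ext[of \<beta> 0] by simp
    then show False using b zero_Phi by blast
  qed
  then show ?thesis by blast
qed

section \<open>Chambers and faces of the reflection arrangement\<close>

abbreviation regular :: "'a set" where
  "regular \<equiv> UNIV - (\<Union>\<beta>\<in>\<Phi>. {v. inner \<beta> v = 0})"

text \<open>No root can change sign on a connected set avoiding its hyperplane. Conversely the sign
  conditions cut out a convex set. Scaling each root by its value at \<open>p\<close> absorbs the
  choice of sign.\<close>

lemma chamber_eq:
  assumes p: "p \<in> regular"
  shows "connected_component_set regular p = (\<Inter>\<beta>\<in>\<Phi>. {u. inner (inner \<beta> p *\<^sub>R \<beta>) u > 0})" (is "?D = ?H")
proof
  show "?D \<subseteq> ?H"
  proof
    fix u assume u: "u \<in> ?D"
    have pD: "p \<in> ?D" using p by (simp add: connected_component_refl)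
    have "inner \<beta> p * inner \<beta> u > 0" if b: "\<beta> \<in> \<Phi>" for \<beta>
    proof (rule ccontr)
      assume neg: "\<not> inner \<beta> p * inner \<beta> u > 0"
      have con: "connected ((\<lambda>x. inner \<beta> x) ` ?D)"
        by (intro connected_continuous_image continuous_intros) simp
      have "0 \<in> (\<lambda>x. inner \<beta> x) ` ?D"
      proof (cases "inner \<beta> p \<le> 0")
        case True
        moreover have "inner \<beta> p \<noteq> 0" using p b by auto
        ultimately have "inner \<beta> u \<ge> 0" using neg by (auto simp: zero_less_mult_iff not_less)
        show ?thesis
          by (rule connectedD_interval[OF con imageI[OF pD] imageI[OF u] True \<open>inner \<beta> u \<ge> 0\<close>])
      next
        case False
        then have 1: "inner \<beta> u \<le> 0" "0 \<le> inner \<beta> p" using neg by (auto simp: zero_less_mult_iff not_less)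
        show ?thesis
          by (rule connectedD_interval[OF con imageI[OF u] imageI[OF pD] 1])
      qed
      then obtain x where "x \<in> ?D" "inner \<beta> x = 0" by auto
      then show False using connected_component_subset[of regular p] b by auto
    qed
    then show "u \<in> ?H" by simp
  qed
  show "?H \<subseteq> ?D"
  proof (rule connected_component_maximal)
    have "inner \<beta> p \<noteq> 0" if "\<beta> \<in> \<Phi>" for \<beta> using p that by auto
    then show "p \<in> ?H" by (auto simp: zero_less_mult_iff linorder_neq_iff)
    show "connected ?H"
      by (intro convex_connected convex_INT convex_halfspace_gt)
    show "?H \<subseteq> regular" by force
  qed
qed

lemma in_closure_chamber:
  obtains p where "p \<in> regular" "v \<in> closure (connected_component_set regular p)"
proof -
  obtain \<rho> where \<rho>: "\<And>\<beta>. \<beta> \<in> \<Phi> \<Longrightarrow> inner \<beta> \<rho> \<noteq> 0" using regular_vector by blast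
  \<comment> \<open>The parameters at which the line through \<open>v\<close> in direction
    \<open>\<rho>\<close> meets a reflecting hyperplane. Hyperplanes through \<open>v\<close> give
    parameter 0, so staying below the nonzero ones keeps the open segment regular.\<close>
  define T where "T = (\<lambda>\<beta>. - inner \<beta> v / inner \<beta> \<rho>) ` \<Phi>"
  have finT: "finite T" unfolding T_def using fin_Phi by simp
  obtain d where d: "d > 0" "\<forall>x\<in>T. x \<noteq> 0 \<longrightarrow> d \<le> dist 0 x"
    using finite_set_avoid[OF finT, of 0] by blast
  define s0 where "s0 = d / 2"
  have s0: "s0 > 0" using d unfolding s0_def by simp
  have reg: "v + s *\<^sub>R \<rho> \<in> regular" if "0 < s" "s \<le> s0" for s
  proof -
    have "inner \<beta> (v + s *\<^sub>R \<rho>) \<noteq> 0" if b: "\<beta> \<in> \<Phi>" for \<beta>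
    proof
      assume "inner \<beta> (v + s *\<^sub>R \<rho>) = 0"
      then have "s = - inner \<beta> v / inner \<beta> \<rho>"
        using \<rho>[OF b] by (simp add: inner_add_right field_simps add_eq_0_iff)
      then have "s \<in> T" unfolding T_def using b by blast
      then have "d \<le> s" using d(2) \<open>0 < s\<close> by auto
      then show False using \<open>s \<le> s0\<close> d(1) unfolding s0_def by simp
    qed
    then show ?thesis by auto
  qed
  let ?p = "v + s0 *\<^sub>R \<rho>"
  have sub: "(\<lambda>s. v + s *\<^sub>R \<rho>) ` {0<..s0} \<subseteq> connected_component_set regular ?p"
  proof (rule connected_component_maximal)
    show "?p \<in> (\<lambda>s. v + s *\<^sub>R \<rho>) ` {0<..s0}" using s0 by (intro imageI) simp
    show "connected ((\<lambda>s. v + s *\<^sub>R \<rho>) ` {0<..s0})"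
      by (intro connected_continuous_image continuous_intros) simp
    show "(\<lambda>s. v + s *\<^sub>R \<rho>) ` {0<..s0} \<subseteq> regular" using reg by (intro image_subsetI) simp
  qed
  have "v \<in> closure (connected_component_set regular ?p)"
    unfolding closure_approachable
  proof (intro allI impI)
    fix e :: real assume e: "e > 0"
    \<comment> \<open>The summand 1 keeps the divisor positive whatever the norm of
      \<open>\<rho>\<close> is.\<close>
    define s where "s = min s0 (e / (2 * (norm \<rho> + 1)))"
    have n: "norm \<rho> + 1 > 0" by (simp add: add_nonneg_pos)
    have s: "0 < s" "s \<le> s0" using s0 e n unfolding s_def by auto
    have "s * norm \<rho> \<le> e / (2 * (norm \<rho> + 1)) * norm \<rho>"
      unfolding s_def by (intro mult_right_mono) auto
    also have "\<dots> \<le> e / 2" using e n by (simp add: field_simps)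
    also have "\<dots> < e" using e by simp
    finally have "dist (v + s *\<^sub>R \<rho>) v < e" using s by (simp add: dist_norm)
    moreover have "v + s *\<^sub>R \<rho> \<in> connected_component_set regular ?p"
      by (rule subsetD[OF sub imageI]) (use s in simp)
    ultimately show "\<exists>y\<in>connected_component_set regular ?p. dist y v < e" by (rule bexI)
  qed
  then show thesis by (rule that[OF reg[OF s0 order.refl]])
qed

text \<open>Take a closed chamber containing \<open>v\<close> and cut it with all reflecting
  hyperplanes through \<open>v\<close>. Roots vanishing at \<open>v\<close> vanish on this face, and
  the others keep the weak sign that they have on the chamber.\<close>

lemma coxeter_cone_at:
  obtains G where "G \<in> coxeter_fan \<Phi>" "v \<in> G"
    "\<And>u \<beta>. u \<in> G \<Longrightarrow> \<beta> \<in> \<Phi> \<Longrightarrow> inner \<beta> v = 0 \<Longrightarrow> inner \<beta> u = 0"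
    "\<And>u \<beta>. u \<in> G \<Longrightarrow> \<beta> \<in> \<Phi> \<Longrightarrow> inner \<beta> v > 0 \<Longrightarrow> inner \<beta> u \<ge> 0"
proof -
  obtain p where p: "p \<in> regular" and v: "v \<in> closure (connected_component_set regular p)"
    using in_closure_chamber by blast
  define D where "D = connected_component_set regular p"
  have pn: "inner \<beta> p \<noteq> 0" if "\<beta> \<in> \<Phi>" for \<beta> using p that by auto
  have D: "D \<in> components regular" unfolding D_def components_def using p by blast
  have Deq: "D = (\<Inter>\<beta>\<in>\<Phi>. {u. inner (inner \<beta> p *\<^sub>R \<beta>) u > 0})"
    unfolding D_def by (rule chamber_eq[OF p])
  have "convex D" unfolding Deq by (intro convex_INT convex_halfspace_gt)
  then have cv: "convex (closure D)" by (rule convex_closure)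
  have ge: "inner (inner \<beta> p *\<^sub>R \<beta>) u \<ge> 0" if "u \<in> closure D" "\<beta> \<in> \<Phi>" for u \<beta>
  proof -
    have "closure D \<subseteq> {u. inner (inner \<beta> p *\<^sub>R \<beta>) u \<ge> 0}"
    proof (rule closure_minimal)
      show "D \<subseteq> {u. inner (inner \<beta> p *\<^sub>R \<beta>) u \<ge> 0}" unfolding Deq using that(2) by force
    qed (rule closed_halfspace_ge)
    then show ?thesis using that(1) by blast
  qed
  \<comment> \<open>The closed chamber is included so that the family is nonempty even when
    \<open>v\<close> lies on no reflecting hyperplane.\<close>
  define F where "F = insert (closure D)
    ((\<lambda>\<beta>. closure D \<inter> {u. inner (inner \<beta> p *\<^sub>R \<beta>) u = 0}) ` {\<beta>\<in>\<Phi>. inner \<beta> v = 0})"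
  have "T face_of closure D" if "T \<in> F" for T
  proof -
    from that consider "T = closure D"
      | \<beta> where "\<beta> \<in> \<Phi>" "T = closure D \<inter> {u. inner (inner \<beta> p *\<^sub>R \<beta>) u = 0}"
      unfolding F_def by blast
    then show ?thesis
    proof cases
      case 1
      then show ?thesis using face_of_refl[OF cv] by simp
    next
      case 2
      show ?thesis unfolding 2(2)
        by (rule face_of_Int_supporting_hyperplane_ge[OF cv ge[OF _ 2(1)]])
    qed
  qed
  then have face: "\<Inter>F face_of closure D" by (intro face_of_Inter) (auto simp: F_def)
  have vF: "v \<in> \<Inter>F" using v unfolding F_def D_def by auto
  then have "\<Inter>F \<in> coxeter_fan \<Phi>"
    unfolding coxeter_fan_def using face D by blast
  moreover have "inner \<beta> u = 0" if "u \<in> \<Inter>F" "\<beta> \<in> \<Phi>" "inner \<beta> v = 0" for u \<beta>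
  proof -
    have "closure D \<inter> {u. inner (inner \<beta> p *\<^sub>R \<beta>) u = 0} \<in> F"
      using that(2,3) unfolding F_def by blast
    then have "u \<in> {u. inner (inner \<beta> p *\<^sub>R \<beta>) u = 0}" using that(1) by blast
    then show ?thesis using pn[OF that(2)] by simp
  qed
  moreover have "inner \<beta> u \<ge> 0" if u: "u \<in> \<Inter>F" "\<beta> \<in> \<Phi>" "inner \<beta> v > 0" for u \<beta>
  proof -
    have "u \<in> closure D" using u(1) unfolding F_def by blast
    then have 1: "inner \<beta> p * inner \<beta> u \<ge> 0" using ge u(2) by simp
    have "inner \<beta> p * inner \<beta> v \<ge> 0" using ge[of v \<beta>] v u(2) unfolding D_def by simp
    then have "inner \<beta> p > 0" using u(3) pn[OF u(2)] by (simp add: zero_le_mult_iff)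
    then show ?thesis using 1 by (simp add: zero_le_mult_iff)
  qed
  ultimately show thesis by (intro that[OF _ vF])
qed

text \<open>Membership in the cone depends only on the signs of the roots \<open>\<delta> x\<close>,
  and the Coxeter cone chosen at a point respects these signs. Thus every point of the cone lies in
  a Coxeter cone contained in it.\<close>

lemma coxeter_refines:
  assumes d: "dual_basis B \<delta>" and S: "S \<subseteq> B" and r: "\<And>x. x \<in> B \<Longrightarrow> \<delta> x \<in> \<Phi>"
  shows "\<exists>F\<subseteq>coxeter_fan \<Phi>. span_cone S = \<Union>F"
proof (intro exI[of _ "{G\<in>coxeter_fan \<Phi>. G \<subseteq> span_cone S}"] conjI)
  show "span_cone S = \<Union>{G \<in> coxeter_fan \<Phi>. G \<subseteq> span_cone S}"
  proof
    show "span_cone S \<subseteq> \<Union>{G \<in> coxeter_fan \<Phi>. G \<subseteq> span_cone S}"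
    proof
      fix v assume v: "v \<in> span_cone S"
      obtain G where G: "G \<in> coxeter_fan \<Phi>" "v \<in> G"
        "\<And>u \<beta>. u \<in> G \<Longrightarrow> \<beta> \<in> \<Phi> \<Longrightarrow> inner \<beta> v = 0 \<Longrightarrow> inner \<beta> u = 0"
        "\<And>u \<beta>. u \<in> G \<Longrightarrow> \<beta> \<in> \<Phi> \<Longrightarrow> inner \<beta> v > 0 \<Longrightarrow> inner \<beta> u \<ge> 0"
        using coxeter_cone_at[of v] by blast
      have "u \<in> span_cone S" if u: "u \<in> G" for u
        unfolding dual_basis_span_cone[OF d S]
      proof (intro CollectI ballI)
        fix x assume x: "x \<in> B"
        have "inner (\<delta> x) v \<ge> 0" "x \<notin> S \<Longrightarrow> inner (\<delta> x) v = 0"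
          using v x unfolding dual_basis_span_cone[OF d S] by auto
        then show "inner (\<delta> x) u \<ge> 0 \<and> (x \<notin> S \<longrightarrow> inner (\<delta> x) u = 0)"
          using G(3)[OF u r[OF x]] G(4)[OF u r[OF x]] by (cases "inner (\<delta> x) v = 0") auto
      qed
      then show "v \<in> \<Union>{G \<in> coxeter_fan \<Phi>. G \<subseteq> span_cone S}" using G by blast
    qed
  qed blast
qed blast

text \<open>A common point has an expansion from each side. Uniqueness makes them equal, so only
  common generators carry nonzero coefficients.\<close>

lemma cluster_cones_inter:
  assumes S: "bip S" and C: "maximal_cpt S I C" "maximal_cpt S I D" and sub: "A \<subseteq> C" "B \<subseteq> D"
  shows "span_cone A \<inter> span_cone B = span_cone (A \<inter> B)"
proof
  have CA: "C \<subseteq> AP I" "D \<subseteq> AP I" using C unfolding maximal_cpt_def by auto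
  have fin: "finite A" "finite B"
    using finite_subset[OF _ finite_AP[OF order.refl]] CA sub by (meson subset_trans)+
  have ext: "expansion S I (\<lambda>x. if x \<in> X then c x else 0)"
    "val I (\<lambda>x. if x \<in> X then c x else 0) = (\<Sum>x\<in>X. c x *\<^sub>R x)"
    if X: "X \<subseteq> Y" "maximal_cpt S I Y" "\<forall>x\<in>X. c x \<ge> 0" for X Y c
  proof -
    have XA: "X \<subseteq> AP I" and cp: "\<forall>x\<in>X. \<forall>y\<in>X. x \<noteq> y \<longrightarrow> cpt S x y"
      using X(1,2) unfolding maximal_cpt_def by blast+
    show "expansion S I (\<lambda>x. if x \<in> X then c x else 0)"
      using XA cp X(3) unfolding expansion_def by auto
    have "val I (\<lambda>x. if x \<in> X then c x else 0) = (\<Sum>x\<in>X. (if x \<in> X then c x else 0) *\<^sub>R x)"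
      unfolding val_def by (rule sum.mono_neutral_right) (use XA finite_AP in auto)
    then show "val I (\<lambda>x. if x \<in> X then c x else 0) = (\<Sum>x\<in>X. c x *\<^sub>R x)" by simp
  qed
  show "span_cone A \<inter> span_cone B \<subseteq> span_cone (A \<inter> B)"
  proof
    fix v assume "v \<in> span_cone A \<inter> span_cone B"
    then obtain c d where c: "\<forall>x\<in>A. c x \<ge> 0" "v = (\<Sum>x\<in>A. c x *\<^sub>R x)"
      and d: "\<forall>x\<in>B. d x \<ge> 0" "v = (\<Sum>x\<in>B. d x *\<^sub>R x)"
      unfolding span_cone_def by blast
    note e = ext[OF sub(1) C(1) c(1)] and e' = ext[OF sub(2) C(2) d(1)]
    have eq: "(\<lambda>x. if x \<in> A then c x else 0) = (\<lambda>x. if x \<in> B then d x else 0)"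
      by (rule expansion_unique[OF S order.refl e(1) e'(1)]) (simp add: e(2) e'(2) flip: c(2) d(2))
    have "c x = 0" if "x \<in> A - B" for x using fun_cong[OF eq, of x] that by simp
    then have "v = (\<Sum>x\<in>A \<inter> B. c x *\<^sub>R x)"
      unfolding c(2) by (intro sum.mono_neutral_right fin) auto
    then show "v \<in> span_cone (A \<inter> B)" unfolding span_cone_def using c(1) by auto
  qed
  have mono: "span_cone T \<subseteq> span_cone U" if "T \<subseteq> U" "finite U" for T U :: "'a set"
  proof
    fix v assume "v \<in> span_cone T"
    then obtain c where c: "\<forall>x\<in>T. c x \<ge> 0" "v = (\<Sum>x\<in>T. c x *\<^sub>R x)" unfolding span_cone_def by blast
    have "v = (\<Sum>x\<in>U. (if x \<in> T then c x else 0) *\<^sub>R x)"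
      unfolding c(2) by (rule sum.mono_neutral_cong_left) (use that in auto)
    then show "v \<in> span_cone U"
      unfolding span_cone_def using c(1)
      by (intro CollectI exI[of _ "\<lambda>x. if x \<in> T then c x else 0"]) auto
  qed
  show "span_cone (A \<inter> B) \<subseteq> span_cone A \<inter> span_cone B"
    using mono[of "A \<inter> B" A] mono[of "A \<inter> B" B] fin by blast
qed

text \<open>By \<open>inner_L\<close> the pairing of a dual root with a generator of the image cone
  is its value under \<open>form\<close>. The cardinality found along with the dual roots yields the
  full dimension.\<close>

lemma cluster_dual_basis:
  assumes S: "bip S" and L: "linear L" "\<And>i. i \<in> I \<Longrightarrow> L (a i) = (if i \<in> S then - 1 else 1) *\<^sub>R fund_weight a i"
    and C: "maximal_cpt S I C"
  obtains \<delta> where "dual_basis (L ` C) \<delta>" "\<And>y. y \<in> L ` C \<Longrightarrow> \<delta> y \<in> \<Phi>"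
proof -
  obtain \<gamma> where g: "card C = card I" "dual_roots S I C \<gamma>"
    using dual_roots_exist[OF S order.refl C] by blast
  have inj: "inj L" by (rule inj_L[OF L])
  have "C \<subseteq> AP I" using C unfolding maximal_cpt_def by (elim conjE)
  then have "finite (L ` C)" using finite_AP[OF order.refl] finite_subset by blast
  moreover have "card (L ` C) = DIM('a)"
    using g(1) card_image[OF inj_on_subset[OF inj subset_UNIV]] by (simp add: I_eq)
  moreover have "\<forall>x\<in>L ` C. inner (\<gamma> (inv L x)) x > 0 \<and>
      (\<forall>y\<in>L ` C. y \<noteq> x \<longrightarrow> inner (\<gamma> (inv L x)) y = 0)"
    using g(2) unfolding dual_roots_def by (auto simp: inv_f_f[OF inj] inner_L[OF L])
  ultimately have "dual_basis (L ` C) (\<gamma> \<circ> inv L)"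
    unfolding dual_basis_def by simp
  moreover have "(\<gamma> \<circ> inv L) y \<in> \<Phi>" if "y \<in> L ` C" for y
    using that g(2) unfolding dual_roots_def by (auto simp: inv_f_f[OF inj])
  ultimately show thesis by (rule that)
qed

end

theorem theorem1p5:
  fixes \<Phi> :: "'a::euclidean_space set"
    and a :: "nat \<Rightarrow> 'a"
    and Iplus Iminus :: "nat set"
    and L :: "'a \<Rightarrow> 'a"
  assumes "root_system \<Phi>"
    and "simple_system \<Phi> a"
    and "bipartition a Iplus Iminus"
    and "linear L"
    and "\<forall>i\<in>{1..DIM('a)}. L (a i) = sgn_bip Iplus i *\<^sub>R fund_weight a i"
  shows "is_fan ((\<lambda>K. L ` K) ` cluster_fan \<Phi> a Iplus Iminus) \<and>
         (\<forall>K \<in> (\<lambda>K. L ` K) ` cluster_fan \<Phi> a Iplus Iminus.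
            \<exists>F \<subseteq> coxeter_fan \<Phi>. K = \<Union>F)"
proof -
  define I where "I = {1..DIM('a)}"
  interpret simple_roots \<Phi> a I
    using assms(1,2) I_def by unfold_locales
  have bp: "Iplus = I - Iminus" "bip Iminus"
    using assms(3) unfolding bipartition_def bip_def orth_def I_def[symmetric]
    by (blast, auto)
  have L: "L (a i) = (if i \<in> Iminus then - 1 else 1) *\<^sub>R fund_weight a i" if "i \<in> I" for i
    using assms(5) that bp(1) unfolding sgn_bip_def I_def by auto
  have inj: "inj L" by (rule inj_L[OF assms(4) L])
  define F where "F = (\<lambda>K. L ` K) ` cluster_fan \<Phi> a Iplus Iminus"
  have F: "K \<in> F \<longleftrightarrow> (\<exists>C S. maximal_cpt Iminus I C \<and> S \<subseteq> C \<and> K = L ` span_cone S)" for K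
    unfolding F_def cluster_fan_def bp(1) using cluster_eq[OF bp(2)] by blast
  have dual: "\<exists>\<delta>. dual_basis (L ` C) \<delta> \<and> (\<forall>y\<in>L ` C. \<delta> y \<in> \<Phi>)" if "maximal_cpt Iminus I C" for C
    by (rule cluster_dual_basis[OF bp(2) assms(4) L that]) auto
  have img: "L ` span_cone S = span_cone (L ` S)" for S
    by (rule linear_image_span_cone[OF assms(4) inj])
  have "is_fan F"
    unfolding is_fan_def
  proof (intro conjI ballI allI impI)
    fix K assume "K \<in> F"
    then obtain C S \<delta> where K: "S \<subseteq> C" "K = span_cone (L ` S)" "dual_basis (L ` C) \<delta>"
      using F dual img by metis
    then show "polyhedron K" using dual_basis_polyhedron[OF K(3) image_mono[OF K(1)]] by simp
    show "cone K" "K \<noteq> {}" using K(2) cone_span_cone zero_span_cone by blast+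
  next
    fix K G assume KG: "K \<in> F" "G face_of K \<and> G \<noteq> {}"
    then obtain C S where K: "maximal_cpt Iminus I C" "S \<subseteq> C" "K = span_cone (L ` S)"
      using F img by metis
    have "finite C" 
      using K(1) finite_subset[OF _ finite_AP[OF order.refl]] unfolding maximal_cpt_def by blast
    then have "finite (L ` S)" using K(2) finite_subset by blast
    then have "G = span_cone (L ` S \<inter> G)" using face_of_span_cone KG K(3) by blast
    moreover have "L ` S \<inter> G = L ` {x\<in>S. L x \<in> G}" by blast
    ultimately have eq: "G = L ` span_cone {x\<in>S. L x \<in> G}" using img by metis
    have "{x\<in>S. L x \<in> G} \<subseteq> C" using K(2) by blast
    with K(1) eq show "G \<in> F" unfolding F by (intro exI conjI)
  next
    fix K1 K2 assume "K1 \<in> F" "K2 \<in> F"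
    then obtain C1 S1 C2 S2 where
      K1: "maximal_cpt Iminus I C1" "S1 \<subseteq> C1" "K1 = L ` span_cone S1" and
      K2: "maximal_cpt Iminus I C2" "S2 \<subseteq> C2" "K2 = L ` span_cone S2"
      using F by metis
    \<comment> \<open>Injectivity lets the intersection be formed before applying \<open>L\<close>.
      It is spanned by the common generators, hence is a face of both simplicial cones.\<close>
    have "K1 \<inter> K2 = L ` (span_cone S1 \<inter> span_cone S2)"
      unfolding K1(3) K2(3) by (rule image_Int[OF inj, symmetric])
    also have "span_cone S1 \<inter> span_cone S2 = span_cone (S1 \<inter> S2)"
      using cluster_cones_inter[OF bp(2)] K1(1,2) K2(1,2) by blast
    finally have eq: "K1 \<inter> K2 = span_cone (L ` (S1 \<inter> S2))" by (simp only: img)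
    from dual[OF K1(1)] obtain \<delta>1 where d1: "dual_basis (L ` C1) \<delta>1" by (elim exE conjE)
    from dual[OF K2(1)] obtain \<delta>2 where d2: "dual_basis (L ` C2) \<delta>2" by (elim exE conjE)
    show "K1 \<inter> K2 face_of K1"
      unfolding eq unfolding K1(3) img by (rule dual_basis_face[OF d1]) (use K1(2) in blast)+
    show "K1 \<inter> K2 face_of K2"
      unfolding eq unfolding K2(3) img by (rule dual_basis_face[OF d2]) (use K2(2) in blast)+
  qed
  moreover have "\<exists>G \<subseteq> coxeter_fan \<Phi>. K = \<Union>G" if KF: "K \<in> F" for K
  proof -
    obtain C S where K: "maximal_cpt Iminus I C" "S \<subseteq> C" "K = span_cone (L ` S)"
      using KF F img by metis
    from dual[OF K(1)] obtain \<delta> where d: "dual_basis (L ` C) \<delta>" "\<forall>y\<in>L ` C. \<delta> y \<in> \<Phi>"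
      by (elim exE conjE)
    show ?thesis unfolding K(3) by (rule coxeter_refines[OF d(1) image_mono[OF K(2)] bspec[OF d(2)]])
  qed
  ultimately show ?thesis unfolding F_def by blast
qed

end
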